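(* Let $g\ge 3$, $k\ge 0$, let $m,n\ge 1$ be odd integers, and let $\alpha,\beta$ be non-negative integers. An $RSM_\Gamma(\Gamma,g;[\,^{\alpha}m,\ ^{\beta}2^kn])$ exists if and only if $\alpha+\beta=2^{k+2}mn$, except possibly in the following cases: (1) $k\ge 2$ and $\beta=0$; or (2) $k=1$ and $\alpha\in\{0,2,4\}$ or $\beta\in\{0,2,4\}$.
   Context: Let $G=\mathbb{Z}_m\times\mathbb{Z}_{2^{k+1}n}$ and let $\Gamma$ be the generalized dihedral group on $G$: underlying set $G\times\mathbb{Z}_2$ with operation $(x,\tau)+(x',\tau')=(x+(-1)^\tau x',\tau+\tau')$. $[\,^{a}x,\,^{b}y]$ denotes the multiset with $a$ copies of $x$ and $b$ copies of $y$. For $S\subseteq\Gamma$ and a list $L$ of positive integers of length $|S|$, an $RSM_\Gamma(S,g;L)$ is an $|S|\times g$ matrix with entries in $\Gamma$ such that each column is a permutation (arrangement) of $S$ and the multiset of orders (in $\Gamma$) of the left-to-right row sums equals $L$. *)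

theory Defs
  imports "HOL-Algebra.Multiplicative_Group" "HOL-Library.Multiset"
begin

text \<open>Generalized dihedral group on G = Z_m x Z_N (written multiplicatively, as HOL-Algebra does).
  An element ((a,b),t) is represented by the triple (a,b,t) with 0 <= a < m, 0 <= b < N, t in {0,1};
  the operation is (x,t) + (x',t') = (x + (-1)^t x', t + t').\<close>

definition gd_mult :: "int \<Rightarrow> int \<Rightarrow> int \<times> int \<times> int \<Rightarrow> int \<times> int \<times> int \<Rightarrow> int \<times> int \<times> int" where
  "gd_mult m N x y =
     (let (a, b, t) = x; (a', b', t') = y; s = (if t = 0 then 1 else -1) in
       ((a + s * a') mod m, (b + s * b') mod N, (t + t') mod 2))"

definition gen_dihedral :: "int \<Rightarrow> int \<Rightarrow> (int \<times> int \<times> int) monoid" where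
  "gen_dihedral m N =
     \<lparr> carrier = {(a, b, t). 0 \<le> a \<and> a < m \<and> 0 \<le> b \<and> b < N \<and> (t = 0 \<or> t = 1)},
       monoid.mult = gd_mult m N,
       monoid.one = (0, 0, 0) \<rparr>"

definition row_sum :: "('a, 'b) monoid_scheme \<Rightarrow> (nat \<Rightarrow> nat \<Rightarrow> 'a) \<Rightarrow> nat \<Rightarrow> nat \<Rightarrow> 'a" where
  "row_sum G M g i = foldl (\<lambda>acc j. acc \<otimes>\<^bsub>G\<^esub> M i j) \<one>\<^bsub>G\<^esub> [0..<g]"

definition is_RSM :: "('a, 'b) monoid_scheme \<Rightarrow> 'a set \<Rightarrow> nat \<Rightarrow> nat multiset \<Rightarrow> (nat \<Rightarrow> nat \<Rightarrow> 'a) \<Rightarrow> bool" where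
  "is_RSM G S g L M \<longleftrightarrow>
     (\<forall>j<g. bij_betw (\<lambda>i. M i j) {..<card S} S) \<and>
     image_mset (\<lambda>i. group.ord G (row_sum G M g i)) (mset [0..<card S]) = L"

definition RSM_exists :: "('a, 'b) monoid_scheme \<Rightarrow> 'a set \<Rightarrow> nat \<Rightarrow> nat multiset \<Rightarrow> bool" where
  "RSM_exists G S g L \<longleftrightarrow> (\<exists>M. is_RSM G S g L M)"

end

theory Submission
  imports Defs "HOL-Library.Product_Plus" "HOL-Combinatorics.Transposition"
begin

text \<open>
  Put \<open>Q = 2\<^sup>kn\<close>, \<open>G = \<int>\<^sub>m \<times> \<int>\<^sub>2\<^sub>Q\<close> and \<open>H = 2G\<close>. There are elements \<open>x, y\<close> of orders \<open>m\<close> and \<open>Q\<close> in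
  \<open>H\<close> with \<open>y - x = \<delta> = 2\<theta>\<close>. Adding \<open>x\<close> (or \<open>y\<close>) to the last column, it is enough for three columns to
  find matrices whose row sums are \<open>0\<close> or \<open>\<delta>\<close>, with \<open>\<delta>\<close> occurring any prescribed number \<open>b\<close> of times up to
  half the order of \<open>\<Gamma>\<close>. Further columns come for free: the case \<open>b = 0\<close> writes the identity map
  of \<open>\<Gamma>\<close> as a pointwise product of two permutations, which splits a column into two.

  For three columns, the rows form four blocks indexed by \<open>H\<close>, each column restricted to a block being a coset
  of \<open>H\<close>. Inside a block one needs \<open>X + Y = W\<close> with permutations \<open>X, Y, W\<close> of \<open>H\<close>. If \<open>k = 0\<close>,
  doubling gives such a triple; if \<open>k \<ge> 1\<close>, it exists up to a defect (the involution) in one row. Replacing \<open>W\<close>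
  by a permutation that differs from it by \<open>0\<close> or \<open>\<delta>\<close> off that row produces the prescribed sums, again with one
  bad row per block. The signs of the dihedral product differ from block to block, so exchanging the
  entries of a column between the bad rows of different blocks repairs all of them at once.
\<close>

section \<open>The generalized dihedral group\<close>

text \<open>Elements of \<open>\<int>\<^sub>m \<times> \<int>\<^sub>N\<close> are handled as integer pairs modulo this lattice.\<close>

definition lat :: "int \<Rightarrow> int \<Rightarrow> (int \<times> int) set" where
  "lat m N = {u. m dvd fst u \<and> N dvd snd u}"

lemma lat_zero: "0 \<in> lat m N"
  and lat_add: "u \<in> lat m N \<Longrightarrow> v \<in> lat m N \<Longrightarrow> u + v \<in> lat m N"
  and lat_diff: "u \<in> lat m N \<Longrightarrow> v \<in> lat m N \<Longrightarrow> u - v \<in> lat m N"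
  and lat_uminus: "u \<in> lat m N \<Longrightarrow> - u \<in> lat m N"
  by (auto simp: lat_def)

lemma lat_minus_commute: "u - v \<in> lat m N \<longleftrightarrow> v - u \<in> lat m N"
  by (auto simp: lat_def dvd_diff_commute)

text \<open>Any integer pair may stand for a rotation part, so products are computed over the
  integers and compared only modulo \<open>lat m N\<close>.\<close>

definition gd_red :: "int \<Rightarrow> int \<Rightarrow> int \<times> int \<Rightarrow> int \<Rightarrow> int \<times> int \<times> int" where
  "gd_red m N u t = (fst u mod m, snd u mod N, t)"

lemma gd_red_eq_iff: "gd_red m N u t = gd_red m N v t' \<longleftrightarrow> u - v \<in> lat m N \<and> t = t'"
  by (auto simp: gd_red_def lat_def mod_eq_dvd_iff)

lemma gd_red_mult:
  "gd_mult m N (gd_red m N u t) (gd_red m N v t') =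
    gd_red m N (if t = 0 then u + v else u - v) ((t + t') mod 2)"
  by (simp add: gd_mult_def gd_red_def mod_simps)

lemma gd_red_in_carrier:
  assumes "m > 0" "N > 0" "t = 0 \<or> t = 1"
  shows "gd_red m N u t \<in> carrier (gen_dihedral m N)"
  using assms by (auto simp: gen_dihedral_def gd_red_def)

lemma carrier_gen_dihedral_eq:
  "carrier (gen_dihedral m N) = {0..<m} \<times> {0..<N} \<times> {0, 1}"
  by (auto simp: gen_dihedral_def)

lemma card_gen_dihedral: "card (carrier (gen_dihedral m N)) = 2 * nat m * nat N"
  by (simp add: carrier_gen_dihedral_eq card_cartesian_product)

lemma gen_dihedral_cases:
  assumes "x \<in> carrier (gen_dihedral m N)"
  obtains u t where "x = gd_red m N u t" "t = 0 \<or> t = 1"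
proof -
  obtain a b t where x: "x = (a, b, t)" by (cases x)
  with assms have "x = gd_red m N (a, b) t" "t = 0 \<or> t = 1"
    by (auto simp: gen_dihedral_def gd_red_def)
  then show ?thesis by (rule that)
qed

lemma mult_gen_dihedral [simp]: "monoid.mult (gen_dihedral m N) = gd_mult m N"
  and one_gen_dihedral: "monoid.one (gen_dihedral m N) = gd_red m N 0 0"
  by (simp_all add: gen_dihedral_def gd_red_def)

section \<open>Group axioms and orders of rotations\<close>

lemma group_gen_dihedral:
  assumes "m > 0" "N > 0"
  shows "group (gen_dihedral m N)"
proof (rule groupI)
  fix x y z
  assume x: "x \<in> carrier (gen_dihedral m N)" and y: "y \<in> carrier (gen_dihedral m N)"
    and z: "z \<in> carrier (gen_dihedral m N)"
  from x obtain u t where x': "x = gd_red m N u t" "t = 0 \<or> t = 1" by (rule gen_dihedral_cases)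
  from y obtain v t' where y': "y = gd_red m N v t'" "t' = 0 \<or> t' = 1" by (rule gen_dihedral_cases)
  from z obtain w t'' where z': "z = gd_red m N w t''" "t'' = 0 \<or> t'' = 1" by (rule gen_dihedral_cases)
  show "x \<otimes>\<^bsub>gen_dihedral m N\<^esub> y \<in> carrier (gen_dihedral m N)"
    using x' y' assms by (auto simp: gd_red_mult intro!: gd_red_in_carrier)
  show "x \<otimes>\<^bsub>gen_dihedral m N\<^esub> y \<otimes>\<^bsub>gen_dihedral m N\<^esub> z =
      x \<otimes>\<^bsub>gen_dihedral m N\<^esub> (y \<otimes>\<^bsub>gen_dihedral m N\<^esub> z)"
    using x' y' z' by (auto simp: gd_red_mult algebra_simps)
next
  show "\<one>\<^bsub>gen_dihedral m N\<^esub> \<in> carrier (gen_dihedral m N)"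
    using assms by (auto simp: one_gen_dihedral intro!: gd_red_in_carrier)
next
  fix x assume "x \<in> carrier (gen_dihedral m N)"
  then obtain u t where x: "x = gd_red m N u t" "t = 0 \<or> t = 1" by (rule gen_dihedral_cases)
  show "\<one>\<^bsub>gen_dihedral m N\<^esub> \<otimes>\<^bsub>gen_dihedral m N\<^esub> x = x"
    using x by (auto simp: one_gen_dihedral gd_red_mult)
  have "gd_red m N (if t = 0 then - u else u) t \<otimes>\<^bsub>gen_dihedral m N\<^esub> x = \<one>\<^bsub>gen_dihedral m N\<^esub>"
    using x by (auto simp: one_gen_dihedral gd_red_mult)
  then show "\<exists>y\<in>carrier (gen_dihedral m N). y \<otimes>\<^bsub>gen_dihedral m N\<^esub> x = \<one>\<^bsub>gen_dihedral m N\<^esub>"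
    using gd_red_in_carrier[OF assms x(2)] by blast
qed

lemma gd_red_pow:
  assumes "m > 0" "N > 0"
  shows "gd_red m N u 0 [^]\<^bsub>gen_dihedral m N\<^esub> (j :: nat) =
    gd_red m N (int j * fst u, int j * snd u) 0"
proof -
  interpret group "gen_dihedral m N" using assms by (rule group_gen_dihedral)
  show ?thesis
  proof (induction j)
    case 0
    then show ?case by (simp add: one_gen_dihedral zero_prod_def)
  next
    case (Suc j)
    then show ?case
      by (simp add: gd_red_mult) (simp add: gd_red_def algebra_simps)
  qed
qed

lemma ord_gd_red:
  assumes "m > 0" "N > 0" "\<And>j :: nat. (int j * fst u, int j * snd u) \<in> lat m N \<longleftrightarrow> d dvd j"
  shows "group.ord (gen_dihedral m N) (gd_red m N u 0) = d"
proof -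
  interpret group "gen_dihedral m N" using assms by (intro group_gen_dihedral)
  have "gd_red m N u 0 [^]\<^bsub>gen_dihedral m N\<^esub> j = \<one>\<^bsub>gen_dihedral m N\<^esub> \<longleftrightarrow> d dvd j" for j :: nat
    by (simp add: gd_red_pow[OF assms(1,2)] one_gen_dihedral gd_red_eq_iff assms(3))
  then show ?thesis
    using ord_unique[of "gd_red m N u 0" d] gd_red_in_carrier[OF assms(1,2)] by blast
qed

text \<open>The three-column core: multiplying the last column by one fixed rotation later turns the
  two row products into elements of the two required orders.\<close>

definition two_valued :: "int \<Rightarrow> int \<Rightarrow> int \<times> int \<Rightarrow> nat \<Rightarrow> bool" where
  "two_valued m N \<delta> b \<longleftrightarrow> (let C = carrier (gen_dihedral m N) in
     \<exists>f1 f2 f3 B. bij_betw f1 {..<card C} C \<and> bij_betw f2 {..<card C} C \<and> bij_betw f3 {..<card C} C \<and>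
       B \<subseteq> {..<card C} \<and> card B = b \<and>
       (\<forall>i<card C. gd_mult m N (gd_mult m N (f1 i) (f2 i)) (f3 i) =
          gd_red m N (if i \<in> B then \<delta> else 0) 0))"

text \<open>
  The rows fall into four blocks according to the reflection parts of their three entries:
  000, 011, 101 and 110 for blocks 0, 1, 2 and 3. The parts are \<open>tau1\<close>, \<open>tau2\<close>, \<open>tau3\<close>, and
  \<open>block_sum\<close> is the signed sum that the dihedral product induces on the rotation parts.
\<close>

definition block_sum :: "nat \<Rightarrow> int \<times> int \<Rightarrow> int \<times> int \<Rightarrow> int \<times> int \<Rightarrow> int \<times> int" where
  "block_sum c x y z =
    (if c = 0 then x + y + z else if c = 1 then x + y - z else if c = 2 then x - y - z else x - y + z)"

definition tau1 :: "nat \<Rightarrow> int" where "tau1 c = (if c < 2 then 0 else 1)"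
definition tau2 :: "nat \<Rightarrow> int" where "tau2 c = (if c = 0 \<or> c = 2 then 0 else 1)"
definition tau3 :: "nat \<Rightarrow> int" where "tau3 c = (if c = 0 \<or> c = 3 then 0 else 1)"

section \<open>Assembling permutations of the group from four blocks\<close>

lemma less_4_cases: "(c :: nat) < 4 \<longleftrightarrow> c = 0 \<or> c = 1 \<or> c = 2 \<or> c = 3"
  by auto

text \<open>As \<open>N\<close> is even, the parity of the second coordinate survives reduction, so
  reflection part and parity separate the four blocks. Surjectivity is then a count.\<close>

lemma column_bij:
  fixes V :: "nat \<times> 'r \<Rightarrow> int \<times> int" and \<tau> p :: "nat \<Rightarrow> int"
  assumes "m > 0" "N > 0" "even N" "finite R" "4 * card R = 2 * nat m * nat N"
    and par: "\<And>c t. c < 4 \<Longrightarrow> t \<in> R \<Longrightarrow> snd (V (c, t)) mod 2 = p c"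
    and tp: "inj_on (\<lambda>c. (\<tau> c, p c)) {..<4}"
    and tau: "\<And>c. \<tau> c = 0 \<or> \<tau> c = 1"
    and inj: "\<And>c t t'. c < 4 \<Longrightarrow> t \<in> R \<Longrightarrow> t' \<in> R \<Longrightarrow> V (c, t) - V (c, t') \<in> lat m N \<Longrightarrow> t = t'"
  shows "bij_betw (\<lambda>i. gd_red m N (V i) (\<tau> (fst i))) ({..<4} \<times> R) (carrier (gen_dihedral m N))"
proof -
  let ?f = "\<lambda>i. gd_red m N (V i) (\<tau> (fst i))"
  have "inj_on ?f ({..<4} \<times> R)"
  proof (rule inj_onI)
    fix i j assume ij: "i \<in> {..<4} \<times> R" "j \<in> {..<4} \<times> R" "?f i = ?f j"
    obtain c t c' t' where [simp]: "i = (c, t)" "j = (c', t')" by (cases i, cases j) auto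
    have ct: "c < 4" "t \<in> R" "c' < 4" "t' \<in> R" using ij by auto
    have l: "V (c, t) - V (c', t') \<in> lat m N" and "\<tau> c = \<tau> c'"
      using ij(3) by (auto simp: gd_red_eq_iff)
    moreover have "p c = p c'"
    proof -
      have "2 dvd snd (V (c, t)) - snd (V (c', t'))"
        by (rule dvd_trans[OF \<open>even N\<close>]) (use l in \<open>simp add: lat_def\<close>)
      then have "snd (V (c, t)) mod 2 = snd (V (c', t')) mod 2" by (rule iffD2[OF mod_eq_dvd_iff])
      then show ?thesis using par[OF ct(1,2)] par[OF ct(3,4)] by (simp only:)
    qed
    ultimately have "c = c'" using inj_onD[OF tp] ct by blast
    with inj[of c t t'] l ij(1,2) show "i = j" by simp
  qed
  moreover have "?f ` ({..<4} \<times> R) = carrier (gen_dihedral m N)"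
  proof (rule card_subset_eq)
    show "finite (carrier (gen_dihedral m N))" by (simp add: carrier_gen_dihedral_eq)
    show "?f ` ({..<4} \<times> R) \<subseteq> carrier (gen_dihedral m N)"
      by (intro image_subsetI gd_red_in_carrier assms(1,2) tau)
    show "card (?f ` ({..<4} \<times> R)) = card (carrier (gen_dihedral m N))"
      using assms(5) card_image[OF calculation] by (simp add: card_gen_dihedral card_cartesian_product)
  qed
  ultimately show ?thesis by (simp add: bij_betw_def)
qed

text \<open>
  In the unpermuted columns, an even or odd second coordinate tells apart the two blocks that share
  a reflection part. These parities happen to be the functions \<open>tau\<close> again, cyclically shifted.
\<close>

lemma two_valuedI:
  fixes V1 V2 V3 :: "nat \<times> 'r \<Rightarrow> int \<times> int" and \<pi>1 \<pi>2 \<pi>3 :: "nat \<times> 'r \<Rightarrow> nat \<times> 'r"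
  defines "I R \<equiv> {..<4} \<times> R"
  assumes mN: "m > 0" "N > 0" "even N" "finite R" "4 * card R = 2 * nat m * nat N"
    and par: "\<And>c t. c < 4 \<Longrightarrow> t \<in> R \<Longrightarrow> snd (V1 (c, t)) mod 2 = tau3 c"
      "\<And>c t. c < 4 \<Longrightarrow> t \<in> R \<Longrightarrow> snd (V2 (c, t)) mod 2 = tau1 c"
      "\<And>c t. c < 4 \<Longrightarrow> t \<in> R \<Longrightarrow> snd (V3 (c, t)) mod 2 = tau2 c"
    and inj: "\<And>c t t'. c < 4 \<Longrightarrow> t \<in> R \<Longrightarrow> t' \<in> R \<Longrightarrow> V1 (c, t) - V1 (c, t') \<in> lat m N \<Longrightarrow> t = t'"
      "\<And>c t t'. c < 4 \<Longrightarrow> t \<in> R \<Longrightarrow> t' \<in> R \<Longrightarrow> V2 (c, t) - V2 (c, t') \<in> lat m N \<Longrightarrow> t = t'"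
      "\<And>c t t'. c < 4 \<Longrightarrow> t \<in> R \<Longrightarrow> t' \<in> R \<Longrightarrow> V3 (c, t) - V3 (c, t') \<in> lat m N \<Longrightarrow> t = t'"
    and perm: "bij_betw \<pi>1 (I R) (I R)" "bij_betw \<pi>2 (I R) (I R)" "bij_betw \<pi>3 (I R) (I R)"
    and tau: "\<And>i. i \<in> I R \<Longrightarrow> tau1 (fst (\<pi>1 i)) = tau1 (fst i)"
      "\<And>i. i \<in> I R \<Longrightarrow> tau2 (fst (\<pi>2 i)) = tau2 (fst i)"
      "\<And>i. i \<in> I R \<Longrightarrow> tau3 (fst (\<pi>3 i)) = tau3 (fst i)"
    and B: "B \<subseteq> I R" "card B = b"
    and sums: "\<And>i. i \<in> I R \<Longrightarrow>
      block_sum (fst i) (V1 (\<pi>1 i)) (V2 (\<pi>2 i)) (V3 (\<pi>3 i)) - (if i \<in> B then \<delta> else 0) \<in> lat m N"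
  shows "two_valued m N \<delta> b"
proof -
  let ?C = "carrier (gen_dihedral m N)"
  define F where "F V \<tau> = (\<lambda>i. gd_red m N (V i) (\<tau> (fst i)))"
    for V :: "nat \<times> 'r \<Rightarrow> int \<times> int" and \<tau> :: "nat \<Rightarrow> int"
  have F: "bij_betw (F V1 tau1) (I R) ?C" "bij_betw (F V2 tau2) (I R) ?C" "bij_betw (F V3 tau3) (I R) ?C"
    unfolding F_def I_def
  proof -
    have tp: "inj_on (\<lambda>c. (tau1 c, tau3 c)) {..<4}" "inj_on (\<lambda>c. (tau2 c, tau1 c)) {..<4}"
      "inj_on (\<lambda>c. (tau3 c, tau2 c)) {..<4}"
      by (auto simp: inj_on_def less_4_cases tau1_def tau2_def tau3_def)
    have t: "tau1 c = 0 \<or> tau1 c = 1" "tau2 c = 0 \<or> tau2 c = 1" "tau3 c = 0 \<or> tau3 c = 1" for c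
      by (auto simp: tau1_def tau2_def tau3_def)
    show "bij_betw (\<lambda>i. gd_red m N (V1 i) (tau1 (fst i))) ({..<4} \<times> R) ?C"
      by (rule column_bij[OF mN _ tp(1) t(1)]) (fact par(1), fact inj(1))
    show "bij_betw (\<lambda>i. gd_red m N (V2 i) (tau2 (fst i))) ({..<4} \<times> R) ?C"
      by (rule column_bij[OF mN _ tp(2) t(2)]) (fact par(2), fact inj(2))
    show "bij_betw (\<lambda>i. gd_red m N (V3 i) (tau3 (fst i))) ({..<4} \<times> R) ?C"
      by (rule column_bij[OF mN _ tp(3) t(3)]) (fact par(3), fact inj(3))
  qed
  have "card (I R) = card ?C" "finite (I R)"
    using mN by (simp_all add: I_def card_gen_dihedral card_cartesian_product)
  then obtain e where e: "bij_betw e {..<card ?C} (I R)"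
    using ex_bij_betw_nat_finite[of "I R"] by (auto simp: atLeast0LessThan)
  let ?f1 = "F V1 tau1 \<circ> (\<pi>1 \<circ> e)" and ?f2 = "F V2 tau2 \<circ> (\<pi>2 \<circ> e)" and ?f3 = "F V3 tau3 \<circ> (\<pi>3 \<circ> e)"
  let ?B = "{i \<in> {..<card ?C}. e i \<in> B}"
  have "bij_betw e ?B B"
  proof (rule bij_betw_subset[OF e])
    have "B \<subseteq> e ` {..<card ?C}" using bij_betw_imp_surj_on[OF e] B(1) by simp
    then show "e ` ?B = B" by blast
  qed auto
  then have cB: "card ?B = b" using B(2) by (auto dest: bij_betw_same_card)
  have row: "gd_mult m N (gd_mult m N (?f1 i) (?f2 i)) (?f3 i) = gd_red m N (if i \<in> ?B then \<delta> else 0) 0"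
    if "i < card ?C" for i
  proof -
    have ei: "e i \<in> I R" using e that by (auto dest: bij_betwE)
    then obtain c t where c: "e i = (c, t)" "c = 0 \<or> c = 1 \<or> c = 2 \<or> c = 3"
      by (auto simp: I_def less_4_cases)
    \<comment> \<open>By \<open>tau\<close>, entries move only between blocks with equal reflection
      part in that column, so the row keeps the sign pattern of its block.\<close>
    have "gd_mult m N (gd_mult m N (?f1 i) (?f2 i)) (?f3 i) =
        gd_red m N (block_sum c (V1 (\<pi>1 (e i))) (V2 (\<pi>2 (e i))) (V3 (\<pi>3 (e i)))) 0"
      using c tau[OF ei]
      by (auto simp: F_def gd_red_mult tau1_def tau2_def tau3_def block_sum_def)
    also have "\<dots> = gd_red m N (if i \<in> ?B then \<delta> else 0) 0"
      using sums[OF ei] c(1) that by (simp add: gd_red_eq_iff)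
    finally show ?thesis .
  qed
  note f = bij_betw_trans[OF bij_betw_trans[OF e perm(1)] F(1)]
    bij_betw_trans[OF bij_betw_trans[OF e perm(2)] F(2)]
    bij_betw_trans[OF bij_betw_trans[OF e perm(3)] F(3)]
  have "?B \<subseteq> {..<card ?C}" by auto
  with cB row f show ?thesis
    unfolding two_valued_def Let_def
    by (intro exI[of _ ?f1] exI[of _ ?f2] exI[of _ ?f3] exI[of _ ?B] conjI allI impI) auto
qed

section \<open>Permutations with two-valued displacement\<close>

lemma eq_if_dvd_diff:
  fixes i j n :: int
  assumes "n dvd i - j" "0 \<le> i" "i < n" "0 \<le> j" "j < n"
  shows "i = j"
  using assms by (metis mod_eq_dvd_iff mod_pos_pos_trivial)

text \<open>
  Subtracting \<open>\<delta> = (-1, -1)\<close> from the members of \<open>P\<close> and nothing from the others is injective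
  modulo the lattice only if \<open>P\<close> is a union of \<open>\<delta>\<close>-orbits. One freely chosen value, at \<open>0\<close>,
  allows in addition an initial segment of the orbit of \<open>0\<close>, so that \<open>P\<close> may have any size \<open>b\<close>.
\<close>

definition shift_map :: "int \<Rightarrow> int \<Rightarrow> nat \<Rightarrow> (int \<times> int \<Rightarrow> bool) \<Rightarrow> int \<times> int \<Rightarrow> int \<times> int" where
  "shift_map m Q b P h =
    (if h \<in> lat m Q then (of_bool (P 0) - int b, of_bool (P 0) - int b)
     else if P h then h + (1, 1) else h)"

lemma lat_diag_iff: "(c, c) \<in> lat m Q \<longleftrightarrow> lcm m Q dvd c"
  by (auto simp: lat_def)

text \<open>Along a diagonal orbit a shifted run can collide only where it ends, and closure under
  \<open>(1, 1)\<close> lets it end only at \<open>0\<close>. The place left vacant is the start of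
  the run, and \<open>0\<close> is sent there. When \<open>P\<close> has \<open>b\<close> members
  this value is forced: the displacements of a permutation of a finite abelian group sum to
  zero.\<close>

lemma shift_map_inj:
  assumes inv: "\<And>u v. u - v \<in> lat m Q \<Longrightarrow> P u = P v"
    and step: "\<And>h. P h \<Longrightarrow> h \<notin> lat m Q \<Longrightarrow> P (h + (1, 1))"
    and zero: "\<not> P 0 \<Longrightarrow> \<not> P (-1, -1) \<and> (int b, int b) \<in> lat m Q"
    and nonzero: "P 0 \<Longrightarrow> P (1 - int b, 1 - int b) \<and> (P (- int b, - int b) \<longrightarrow> (int b, int b) \<in> lat m Q)"
    and eq: "shift_map m Q b P h - shift_map m Q b P h' \<in> lat m Q"
  shows "h - h' \<in> lat m Q"
proof -
  have key: False
    if "h \<in> lat m Q" "h' \<notin> lat m Q" "shift_map m Q b P h - shift_map m Q b P h' \<in> lat m Q" for h h'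
  proof (cases "P 0")
    case True
    show False
    proof (cases "P h'")
      case True
      then have l: "(1 - int b, 1 - int b) - (h' + (1, 1)) \<in> lat m Q"
        using that \<open>P 0\<close> by (simp add: shift_map_def)
      then have l': "(- int b, - int b) - h' \<in> lat m Q"
        by (cases h') (simp add: lat_def diff_diff_eq2 diff_diff_eq)
      with inv True nonzero \<open>P 0\<close> have "(int b, int b) \<in> lat m Q" by blast
      from lat_add[OF this l'] have "- h' \<in> lat m Q" by (cases h') (simp add: zero_prod_def[symmetric])
      then show False using that(2) lat_uminus by fastforce
    next
      case False
      then have "(1 - int b, 1 - int b) - h' \<in> lat m Q"
        using that \<open>P 0\<close> by (simp add: shift_map_def)
      then show False using inv False nonzero \<open>P 0\<close> by blast
    qed
  next
    case False
    note z = zero[OF this]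
    show False
    proof (cases "P h'")
      case True
      then have "(- int b, - int b) - (h' + (1, 1)) \<in> lat m Q"
        using that \<open>\<not> P 0\<close> by (simp add: shift_map_def)
      then have "(- int b, - int b) - (h' + (1, 1)) + (int b, int b) \<in> lat m Q"
        using z lat_add by blast
      then have "(-1, -1) - h' \<in> lat m Q" by (cases h') (simp add: diff_diff_eq add.commute minus_diff_commute[of _ 1])
      then show False using inv True z by blast
    next
      case nP: False
      then have "(- int b, - int b) - h' \<in> lat m Q"
        using that \<open>\<not> P 0\<close> by (simp add: shift_map_def)
      then have "(- int b, - int b) - h' + (int b, int b) \<in> lat m Q"
        using z lat_add by blast
      then have "- h' \<in> lat m Q" by (cases h') (simp add: algebra_simps)
      then show False using that(2) lat_uminus by fastforce
    qed
  qed
  have key2: False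
    if "h \<notin> lat m Q" "h' \<notin> lat m Q" "P h" "\<not> P h'" "h + (1, 1) - h' \<in> lat m Q" for h h'
    using step[OF that(3,1)] inv[OF that(5)] that(4) by blast
  show ?thesis
  proof (cases "h \<in> lat m Q \<or> h' \<in> lat m Q")
    case True
    then show ?thesis
      using key[of h h'] key[of h' h] eq lat_minus_commute lat_diff by blast
  next
    case False
    then show ?thesis
      using eq key2[of h h'] key2[of h' h] lat_minus_commute[of "h + (1, 1)" h']
        lat_minus_commute[of "h' + (1, 1)" h]
      by (auto simp: shift_map_def lat_minus_commute split: if_splits)
  qed
qed

text \<open>The element \<open>(1, 1)\<close> has order \<open>lcm m Q\<close>, and its
  \<open>gcd m Q\<close> orbits are told apart by \<open>u - v\<close> modulo the gcd. Division of
  \<open>b\<close> by the lcm gives the number of whole orbits to take; the remainder is a run in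
  the orbit of \<open>0\<close>.\<close>

lemma exists_shift_set:
  fixes m Q :: int and b :: nat
  assumes m: "m > 0" and Q: "Q > 0" and b: "int b \<le> m * Q"
  shows "\<exists>P. (\<forall>u v. u - v \<in> lat m Q \<longrightarrow> P u = P v) \<and>
    card {h \<in> {0..<m} \<times> {0..<Q}. P h} = b \<and> (int b < m * Q \<longrightarrow> \<not> P (1, 1)) \<and>
    (\<forall>h h'. shift_map m Q b P h - shift_map m Q b P h' \<in> lat m Q \<longrightarrow> h - h' \<in> lat m Q)"
\<comment> \<open>Only for this value must the orbit of \<open>0\<close> be taken as a whole;
  otherwise \<open>q < d\<close> leaves it free for the run.\<close>
proof (cases "int b = m * Q")
  case True
  define P where "P = (\<lambda>_ :: int \<times> int. True)"
  have "card {h \<in> {0..<m} \<times> {0..<Q}. P h} = nat m * nat Q"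
    by (simp add: P_def card_cartesian_product)
  also have "\<dots> = b" using True m Q by (metis nat_int nat_mult_distrib less_imp_le)
  finally have c: "card {h \<in> {0..<m} \<times> {0..<Q}. P h} = b" .
  have "(int b, int b) \<in> lat m Q" using True by (simp add: lat_def)
  then have "h - h' \<in> lat m Q" if "shift_map m Q b P h - shift_map m Q b P h' \<in> lat m Q" for h h'
    by (intro shift_map_inj[OF _ _ _ _ that]) (auto simp: P_def)
  with c True show ?thesis by (intro exI[of _ P]) (simp add: P_def)
next
  case False
  define d where "d = gcd m Q"
  define L where "L = lcm m Q"
  define q where "q = int b div L"
  define j0 where "j0 = int b mod L"
  have dL: "d * L = m * Q" using m Q by (simp add: d_def L_def)
  have d: "d > 0" "d dvd m" "d dvd Q" using m Q by (auto simp: d_def)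
  have L: "L > 0" using m Q by (simp add: L_def lcm_pos_int)
  have j0: "0 \<le> j0" "j0 < L" using L by (auto simp: j0_def)
  have bq: "int b = q * L + j0" by (simp add: q_def j0_def)
  have q: "0 \<le> q" "q < d"
  proof -
    show "0 \<le> q" using L by (simp add: q_def pos_imp_zdiv_nonneg_iff)
    have "q * L < d * L" using bq j0 dL b False by linarith
    then show "q < d" using L by simp
  qed
  have Ldvd: "m dvd c \<and> Q dvd c \<longleftrightarrow> L dvd c" for c by (simp add: L_def)
  \<comment> \<open>The whole orbits have \<open>u - v\<close> congruent to
    \<open>-q, ..., -1\<close> modulo \<open>d\<close>, which avoids \<open>0\<close>. The run
    consists of \<open>0\<close> and the \<open>j0 - 1\<close> points behind it, and is empty if
    \<open>j0 = 0\<close>.\<close>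
  define P where "P = (\<lambda>(u, v). (u - v + q) mod d < q \<or>
    (\<exists>j. 0 \<le> j \<and> j < j0 \<and> m dvd j + u \<and> Q dvd j + v))"
  have inv: "P u = P v" if "u - v \<in> lat m Q" for u v
  proof -
    obtain a b c e where uv: "u = (a, b)" "v = (c, e)" by (cases u, cases v)
    have l: "m dvd a - c" "Q dvd b - e" using that uv by (auto simp: lat_def)
    then have "d dvd (a - b + q) - (c - e + q)"
      using dvd_diff[OF dvd_trans[OF d(2) l(1)] dvd_trans[OF d(3) l(2)]] by (simp add: algebra_simps)
    then have "(a - b + q) mod d = (c - e + q) mod d" by (simp add: mod_eq_dvd_iff)
    moreover have "m dvd j + a \<longleftrightarrow> m dvd j + c" "Q dvd j + b \<longleftrightarrow> Q dvd j + e" for j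
      using dvd_add_right_iff[OF l(1), of "j + c"] dvd_add_right_iff[OF l(2), of "j + e"]
      by (simp_all add: algebra_simps)
    ultimately show ?thesis by (simp add: P_def uv)
  qed
  have diag: "P (c, c) \<longleftrightarrow> (\<exists>j. 0 \<le> j \<and> j < j0 \<and> L dvd j + c)" for c
    using q Ldvd by (simp add: P_def)
  have not11: "\<not> P (1, 1)"
  proof
    assume "P (1, 1)"
    then obtain j where j: "0 \<le> j" "j < j0" "L dvd j + 1" by (auto simp: diag)
    then have "L \<le> j + 1" by (intro zdvd_imp_le) auto
    then show False using j j0 by simp
  qed
  have inj: "h - h' \<in> lat m Q" if "shift_map m Q b P h - shift_map m Q b P h' \<in> lat m Q" for h h'
  proof (rule shift_map_inj[OF inv _ _ _ that])
    fix h assume h: "P h" "h \<notin> lat m Q"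
    obtain u v where uv: "h = (u, v)" by (cases h)
    show "P (h + (1, 1))"
    proof (cases "(u - v + q) mod d < q")
      case True
      then show ?thesis by (simp add: P_def uv)
    next
      case False
      then obtain j where j: "0 \<le> j" "j < j0" "m dvd j + u" "Q dvd j + v"
        using h by (auto simp: P_def uv)
      with h uv have "j \<noteq> 0" by (auto simp: lat_def)
      with j show ?thesis
        by (auto simp: P_def uv intro!: exI[of _ "j - 1"])
    qed
  next
    assume "\<not> P 0"
    then have "j0 = 0" using j0 diag[of 0] by (force simp: zero_prod_def)
    then show "\<not> P (-1, -1) \<and> (int b, int b) \<in> lat m Q"
      using bq by (simp add: diag lat_diag_iff L_def[symmetric])
  next
    assume "P 0"
    then have "j0 > 0" using diag[of 0] by (force simp: zero_prod_def)
    then have "P (1 - int b, 1 - int b)"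
      unfolding diag using bq by (intro exI[of _ "j0 - 1"]) auto
    moreover have "\<not> P (- int b, - int b)"
    proof
      assume "P (- int b, - int b)"
      then obtain j where j: "0 \<le> j" "j < j0" "L dvd j - (q * L + j0)"
        using bq unfolding diag by (metis diff_conv_add_uminus)
      then have "L dvd (j - (q * L + j0)) + q * L" by (intro dvd_add) auto
      then have "j = j0" using j j0 by (intro eq_if_dvd_diff) auto
      then show False using j by simp
    qed
    ultimately show "P (1 - int b, 1 - int b) \<and>
      (P (- int b, - int b) \<longrightarrow> (int b, int b) \<in> lat m Q)" by blast
  qed
  have card: "card {h \<in> {0..<m} \<times> {0..<Q}. P h} = b"
  proof -
    define J where "J = {0..<d} \<times> {0..<L}"
    \<comment> \<open>Orbit coordinates: \<open>i\<close> is \<open>u - v + q\<close> modulo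
      \<open>d\<close>, and \<open>j\<close> counts steps back from \<open>(i - q, 0)\<close>. The
      orbit of \<open>0\<close> is \<open>i = q\<close>.\<close>
    define e where "e = (\<lambda>(i, j). ((i - q - j) mod m, (- j) mod Q))"
    have same: "i = i' \<and> j = j'" if ij: "i \<in> {0..<d}" "i' \<in> {0..<d}" "j \<in> {0..<L}" "j' \<in> {0..<L}"
      and dv: "m dvd (i - j) - (i' - j')" "Q dvd j - j'" for i i' j j'
    proof -
      have "d dvd (i - j) - (i' - j') + (j - j')" using d dv by (meson dvd_add dvd_trans)
      then have "d dvd i - i'" by simp
      then have i: "i = i'" using ij by (auto intro: eq_if_dvd_diff)
      then have "m dvd j - j'" using dv(1) by (simp add: dvd_diff_commute)
      with dv(2) have "L dvd j - j'" using Ldvd by blast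
      with i show ?thesis using ij by (auto intro: eq_if_dvd_diff)
    qed
    have e_inj: "inj_on e J"
    proof (rule inj_onI)
      fix x y assume "x \<in> J" "y \<in> J" "e x = e y"
      then show "x = y"
        using same[of "fst x" "fst y" "snd x" "snd y"]
        by (auto simp: J_def e_def mod_eq_dvd_iff algebra_simps dvd_diff_commute)
    qed
    have cJ: "card J = card ({0..<m} \<times> {0..<Q})"
      using dL m Q d L by (simp add: J_def card_cartesian_product flip: nat_mult_distrib)
    have img: "e ` J = {0..<m} \<times> {0..<Q}"
      by (rule card_subset_eq) (use m Q cJ card_image[OF e_inj] in \<open>auto simp: e_def\<close>)
    define K where "K = {0..<q} \<times> {0..<L} \<union> {q} \<times> {0..<j0}"
    have Pe: "P (e x) \<longleftrightarrow> x \<in> K" if "x \<in> J" for x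
    proof -
      obtain i j where x: "x = (i, j)" by (cases x)
      have ij: "i \<in> {0..<d}" "j \<in> {0..<L}" using that x by (auto simp: J_def)
      have "P (e x) = P (i - q - j, - j)"
        by (rule inv) (simp add: x e_def lat_def mod_eq_dvd_iff[symmetric] del: diff_minus_eq_add)
      also have "\<dots> \<longleftrightarrow> i < q \<or> (\<exists>j'. 0 \<le> j' \<and> j' < j0 \<and> m dvd j' + (i - q - j) \<and> Q dvd j' - j)"
        using ij by (simp add: P_def)
      also have "\<dots> \<longleftrightarrow> i < q \<or> i = q \<and> j < j0"
      proof -
        have "i = q \<and> j = j'" if "0 \<le> j'" "j' < j0" "m dvd j' + (i - q - j)" "Q dvd j' - j" for j'
          using same[of i q j j'] that ij q j0
          by (auto simp: algebra_simps dvd_diff_commute)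
        then show ?thesis using ij by force
      qed
      finally show ?thesis using ij x by (auto simp: K_def)
    qed
    have KJ: "K \<subseteq> J" using q j0 by (auto simp: K_def J_def)
    have "{h \<in> {0..<m} \<times> {0..<Q}. P h} = e ` K"
      unfolding img[symmetric] using Pe KJ by auto
    then have "card {h \<in> {0..<m} \<times> {0..<Q}. P h} = card K"
      using card_image inj_on_subset[OF e_inj KJ] by metis
    also have "\<dots> = nat q * nat L + nat j0"
      unfolding K_def by (subst card_Un_disjoint) (auto simp: card_cartesian_product)
    also have "\<dots> = b"
      using bq q L j0 by (metis nat_add_distrib nat_int nat_mult_distrib less_imp_le mult_nonneg_nonneg)
    finally show ?thesis .
  qed
  show ?thesis
    by (intro exI[of _ P] conjI allI impI; (rule inv card not11 inj)?; assumption?)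
qed

section \<open>Repairing the exceptional rows by exchanges\<close>

lemma bij_betw_transpose: "i \<in> I \<Longrightarrow> j \<in> I \<Longrightarrow> bij_betw (transpose i j) I I"
  by (rule bij_betw_byWitness[where f' = "transpose i j"]) (auto simp: transpose_def)

text \<open>
  Before the exchanges, all rows but the four rows \<open>a\<close> have the wanted sum. Exchanging entries among
  the rows \<open>a\<close> repairs these four. The exchange among the rows \<open>o'\<close> of blocks 0, 1, 2 moves the
  first two entries of the row in block 0 by \<open>\<theta>\<close> each and preserves the sums of the other two rows;
  it is what allows an odd number of sums \<open>\<delta>\<close>.
\<close>

lemma two_valued_near_complete:
  fixes X Y W Z :: "'r \<Rightarrow> int \<times> int" and odd_count :: bool
  assumes mN: "m > 0" "N > 0" "even N" "finite R" "4 * card R = 2 * nat m * nat N"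
    and ao: "a \<in> R" "o' \<in> R" "a \<noteq> o'"
    and ev: "\<And>t. t \<in> R \<Longrightarrow> even (snd (X t)) \<and> even (snd (Y t)) \<and> even (snd (W t)) \<and> even (snd (Z t))"
    and inj: "\<And>t t'. t \<in> R \<Longrightarrow> t' \<in> R \<Longrightarrow> X t - X t' \<in> lat m N \<Longrightarrow> t = t'"
      "\<And>t t'. t \<in> R \<Longrightarrow> t' \<in> R \<Longrightarrow> Y t - Y t' \<in> lat m N \<Longrightarrow> t = t'"
      "\<And>t t'. t \<in> R \<Longrightarrow> t' \<in> R \<Longrightarrow> W t - W t' \<in> lat m N \<Longrightarrow> t = t'"
      "\<And>t t'. t \<in> R \<Longrightarrow> t' \<in> R \<Longrightarrow> Z t - Z t' \<in> lat m N \<Longrightarrow> t = t'"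
    and par: "odd (snd \<theta>)" "even (snd \<iota>)" "even (snd \<sigma>)" "\<delta> = \<theta> + \<theta>"
    and sum: "\<And>t. t \<in> R \<Longrightarrow> t \<noteq> a \<Longrightarrow> X t + Y t - W t \<in> lat m N"
    and at_a: "X a - \<delta> \<in> lat m N" "Y a - \<iota> \<in> lat m N" "W a - \<delta> \<in> lat m N"
    and at_o: "X o' \<in> lat m N" "Y o' \<in> lat m N" "W o' \<in> lat m N"
    and D: "D \<subseteq> R" "odd_count \<Longrightarrow> o' \<notin> D"
    and Z: "\<And>t. t \<in> R \<Longrightarrow> t \<noteq> a \<Longrightarrow> W t - Z t - (if t \<in> D then \<delta> else 0) \<in> lat m N"
      "Z a - (\<delta> + \<sigma> - (if a \<in> D then \<delta> else 0)) \<in> lat m N"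
  shows "two_valued m N \<delta> (2 * card D + of_bool odd_count)"
proof -
  \<comment> \<open>Off the rows \<open>a\<close> the offsets cancel: blocks 0 and 2 sum to
    \<open>X + Y - W\<close>, blocks 1 and 3 to \<open>X + Y - Z\<close>. In row \<open>a\<close>,
    \<open>\<iota>\<close> is the defect of \<open>X + Y = W\<close> and \<open>\<sigma>\<close> the
    displacement of \<open>Z\<close>; putting them into block 3 makes them available to the
    exchanges.\<close>
  define V1 where "V1 = (\<lambda>(c :: nat, t). if c = 0 then X t else if c = 1 then \<theta> + Y t
    else if c = 2 then \<theta> + X t else X t + \<iota>)"
  define V2 where "V2 = (\<lambda>(c :: nat, t). if c = 0 then Y t else if c = 1 then X t
    else if c = 2 then \<theta> - Y t else \<theta> - Y t + \<iota> + \<sigma>)"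
  define V3 where "V3 = (\<lambda>(c :: nat, t). if c = 0 then - W t else if c = 1 then \<theta> + Z t
    else if c = 2 then W t else \<theta> - Z t + \<sigma>)"
  note V = V1_def V2_def V3_def
  \<comment> \<open>At \<open>a\<close>, for instance, block 0 receives
    \<open>\<theta> + Y a\<close> and \<open>\<theta> - Y a\<close>, whose sum
    \<open>\<delta>\<close> is \<open>W a\<close> modulo the lattice, so the defect
    disappears.\<close>
  define \<pi>1 where "\<pi>1 = (if odd_count then transpose (0, o') (1, o') else id)
    \<circ> (transpose (0 :: nat, a) (1, a) \<circ> transpose (2, a) (3, a))"
  define \<pi>2 where "\<pi>2 = (if odd_count then transpose (0, o') (2, o') else id)
    \<circ> (transpose (0 :: nat, a) (2, a) \<circ> transpose (1, a) (3, a))"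
  define \<pi>3 where "\<pi>3 = (if odd_count then transpose (1, o') (2, o') else (id :: nat \<times> 'r \<Rightarrow> nat \<times> 'r))"
  note \<pi> = \<pi>1_def \<pi>2_def \<pi>3_def
  \<comment> \<open>Blocks 1 and 3 both use \<open>Z\<close>, so each member of \<open>D\<close>
    yields two rows with sum \<open>\<delta>\<close>; the row \<open>(0, o')\<close> can supply a
    single one.\<close>
  define B where "B = {1, 3 :: nat} \<times> D \<union> (if odd_count then {(0, o')} else {})"
  have finD: "finite D" using D(1) mN(4) by (rule finite_subset)
  show ?thesis
  proof (rule two_valuedI[where ?V1.0 = V1 and ?V2.0 = V2 and ?V3.0 = V3
        and ?\<pi>1.0 = \<pi>1 and ?\<pi>2.0 = \<pi>2 and ?\<pi>3.0 = \<pi>3 and B = B, OF mN])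
    fix c :: nat and t assume ct: "c < 4" "t \<in> R"
    have "odd (snd v) \<Longrightarrow> snd v mod 2 = 1" "even (snd v) \<Longrightarrow> snd v mod 2 = 0" for v :: "int \<times> int"
      by (simp_all add: odd_iff_mod_2_eq_one)
    then show "snd (V1 (c, t)) mod 2 = tau3 c" "snd (V2 (c, t)) mod 2 = tau1 c"
      "snd (V3 (c, t)) mod 2 = tau2 c"
      using ct ev[OF ct(2)] par by (auto simp: V less_4_cases tau1_def tau2_def tau3_def)
  next
    fix c :: nat and t t' assume ct: "c < 4" "t \<in> R" "t' \<in> R"
    note i = inj[OF ct(2,3)] inj[OF ct(3,2)]
    show "t = t'" if "V1 (c, t) - V1 (c, t') \<in> lat m N"
      using that i by (auto simp: V split: if_splits)
    show "t = t'" if "V2 (c, t) - V2 (c, t') \<in> lat m N"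
      using that i by (auto simp: V split: if_splits)
    show "t = t'" if "V3 (c, t) - V3 (c, t') \<in> lat m N"
      using that i by (auto simp: V split: if_splits)
  next
    show "bij_betw \<pi>1 ({..<4} \<times> R) ({..<4} \<times> R)" "bij_betw \<pi>2 ({..<4} \<times> R) ({..<4} \<times> R)"
      "bij_betw \<pi>3 ({..<4} \<times> R) ({..<4} \<times> R)"
      using ao unfolding \<pi>
      by (auto intro!: bij_betw_trans bij_betw_transpose)
  next
    fix i :: "nat \<times> 'r" assume "i \<in> {..<4} \<times> R"
    then show "tau1 (fst (\<pi>1 i)) = tau1 (fst i)" "tau2 (fst (\<pi>2 i)) = tau2 (fst i)"
      "tau3 (fst (\<pi>3 i)) = tau3 (fst i)"
      by (auto simp: \<pi> transpose_def tau1_def tau2_def tau3_def)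
  next
    show "B \<subseteq> {..<4} \<times> R" using D ao by (auto simp: B_def)
    show "card B = 2 * card D + of_bool odd_count"
      using finD by (auto simp: B_def card_cartesian_product card_insert_if)
  next
    fix i :: "nat \<times> 'r" assume i: "i \<in> {..<4} \<times> R"
    obtain c t where [simp]: "i = (c, t)" by (cases i)
    have c: "c = 0 \<or> c = 1 \<or> c = 2 \<or> c = 3" and t: "t \<in> R" using i by (auto simp: less_4_cases)
    have eq: "v \<in> lat m N" if "u \<in> lat m N" "v = u" for u v using that by simp
    show "block_sum (fst i) (V1 (\<pi>1 i)) (V2 (\<pi>2 i)) (V3 (\<pi>3 i)) - (if i \<in> B then \<delta> else 0) \<in> lat m N"
    proof (cases "t = a")
      case True
      have 0: "\<theta> + Y a + (\<theta> - Y a) + - W a \<in> lat m N"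
        by (rule eq[OF lat_uminus[OF at_a(3)]]) (simp add: par(4))
      have 1: "X a + (\<theta> - Y a + \<iota> + \<sigma>) - (\<theta> + Z a) - (if a \<in> D then \<delta> else 0) \<in> lat m N"
        by (rule eq[OF lat_diff[OF lat_diff[OF at_a(1,2)] Z(2)]]) (simp add: algebra_simps)
      have 2: "X a + \<iota> - Y a - W a \<in> lat m N"
        by (rule eq[OF lat_diff[OF lat_diff[OF at_a(1,2)] at_a(3)]]) (simp add: algebra_simps)
      have 3: "\<theta> + X a - X a + (\<theta> - Z a + \<sigma>) - (if a \<in> D then \<delta> else 0) \<in> lat m N"
        by (rule eq[OF lat_uminus[OF Z(2)]]) (simp add: par(4) algebra_simps)
      from 0 1 2 3 show ?thesis
        using c ao(3) True by (auto simp: block_sum_def \<pi> transpose_def V B_def)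
    next
      case ta: False
      note s = sum[OF t ta] and z = Z(1)[OF t ta]
      show ?thesis
      proof (cases "t = o' \<and> odd_count \<and> c \<noteq> 3")
        case True
        \<comment> \<open>The exchange in the third column gives block 2 the entry built from
          \<open>Z o'\<close>, which must therefore agree with \<open>W o'\<close>.\<close>
        have zo: "W o' - Z o' \<in> lat m N" using Z(1)[OF ao(2)] ao(3) D(2) True by auto
        have 0: "\<theta> + Y o' + (\<theta> - Y o') + - W o' - \<delta> \<in> lat m N"
          by (rule eq[OF lat_uminus[OF at_o(3)]]) (simp add: par(4))
        have 1: "X o' + X o' - W o' \<in> lat m N"
          by (intro lat_diff lat_add at_o)
        have 2: "\<theta> + X o' - Y o' - (\<theta> + Z o') \<in> lat m N"
          by (rule eq[OF lat_add[OF lat_diff[OF lat_diff[OF at_o(1,2)] at_o(3)] zo]]) (simp add: algebra_simps)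
        from 0 1 2 show ?thesis
          using c ao(3) True D(2) by (auto simp: block_sum_def \<pi> transpose_def V B_def)
      next
        case False
        have 1: "\<theta> + Y t + X t - (\<theta> + Z t) - (if t \<in> D then \<delta> else 0) \<in> lat m N"
          by (rule eq[OF lat_add[OF s z]]) (simp add: algebra_simps)
        have 2: "\<theta> + X t - (\<theta> - Y t) - W t \<in> lat m N"
          by (rule eq[OF s]) (simp add: algebra_simps)
        have 3: "X t + \<iota> - (\<theta> - Y t + \<iota> + \<sigma>) + (\<theta> - Z t + \<sigma>) - (if t \<in> D then \<delta> else 0) \<in> lat m N"
          by (rule eq[OF lat_add[OF s z]]) (simp add: algebra_simps)
        from s 1 2 3 show ?thesis
          using c ta False by (auto simp: block_sum_def \<pi> transpose_def V B_def)
      qed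
    qed
  qed
qed

text \<open>
  For odd \<open>Q\<close> the doubling map is a complete mapping of \<open>2G\<close>, and a single exchange among three of
  the rows \<open>a\<close> suffices, since the sum of the three corrections can be halved.
\<close>

lemma two_valued_complete:
  fixes X W Z0 Z1 :: "'r \<Rightarrow> int \<times> int"
  assumes mN: "m > 0" "N > 0" "even N" "finite R" "4 * card R = 2 * nat m * nat N"
    and a: "a \<in> R"
    and ev: "\<And>t. t \<in> R \<Longrightarrow> even (snd (X t)) \<and> even (snd (W t)) \<and> even (snd (Z0 t)) \<and> even (snd (Z1 t))"
    and inj: "\<And>t t'. t \<in> R \<Longrightarrow> t' \<in> R \<Longrightarrow> X t - X t' \<in> lat m N \<Longrightarrow> t = t'"
      "\<And>t t'. t \<in> R \<Longrightarrow> t' \<in> R \<Longrightarrow> W t - W t' \<in> lat m N \<Longrightarrow> t = t'"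
      "\<And>t t'. t \<in> R \<Longrightarrow> t' \<in> R \<Longrightarrow> Z0 t - Z0 t' \<in> lat m N \<Longrightarrow> t = t'"
      "\<And>t t'. t \<in> R \<Longrightarrow> t' \<in> R \<Longrightarrow> Z1 t - Z1 t' \<in> lat m N \<Longrightarrow> t = t'"
    and par: "odd (snd \<omega>)" "even (snd p)" "even (snd \<sigma>0)" "even (snd \<sigma>1)" "even (snd \<delta>)"
    and \<omega>: "\<omega> + \<omega> \<in> lat m N" and p: "p + p - (\<sigma>0 - \<sigma>1) \<in> lat m N"
    and sum: "\<And>t. t \<in> R \<Longrightarrow> X t + X t - W t \<in> lat m N"
    and D: "D0 \<subseteq> R" "D1 \<subseteq> R"
    and Z0: "\<And>t. t \<in> R \<Longrightarrow> t \<noteq> a \<Longrightarrow> W t - Z0 t - (if t \<in> D0 then \<delta> else 0) \<in> lat m N"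
      "Z0 a - (\<sigma>0 - (if a \<in> D0 then \<delta> else 0)) \<in> lat m N"
    and Z1: "\<And>t. t \<in> R \<Longrightarrow> t \<noteq> a \<Longrightarrow> W t - Z1 t - (if t \<in> D1 then \<delta> else 0) \<in> lat m N"
      "Z1 a - (\<sigma>1 - (if a \<in> D1 then \<delta> else 0)) \<in> lat m N"
  shows "two_valued m N \<delta> (card D0 + card D1)"
proof -
  \<comment> \<open>After the exchange, row \<open>a\<close> of block 1 has third entry
    \<open>W a - \<epsilon>\<close>, hence sum \<open>\<epsilon>\<close>, as \<open>D1\<close>
    demands. In the other rows of block 2 the two occurrences of \<open>\<epsilon>\<close>
    cancel.\<close>
  define \<epsilon> where "\<epsilon> = (if a \<in> D1 then \<delta> else 0)"
  \<comment> \<open>The sign of \<open>\<omega>\<close> is immaterial modulo the lattice. Off row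
    \<open>a\<close>, block 2 sums to \<open>X + X - W\<close> plus
    \<open>p + p - (\<sigma>0 - \<sigma>1)\<close>; this is what fixes \<open>p\<close> as a
    half.\<close>
  define V1 where "V1 = (\<lambda>(c :: nat, t). if c = 0 then X t else if c = 1 then \<omega> + X t + p
    else if c = 2 then \<omega> + X t + p + \<sigma>1 - \<epsilon> else X t)"
  define V2 where "V2 = (\<lambda>(c :: nat, t). if c = 0 then X t else if c = 1 then X t
    else if c = 2 then \<omega> - X t + \<sigma>0 - p else \<omega> - X t)"
  define V3 where "V3 = (\<lambda>(c :: nat, t). if c = 0 then - Z0 t else if c = 1 then \<omega> + Z1 t + p
    else if c = 2 then W t - \<epsilon> else \<omega> - W t)"
  note V = V1_def V2_def V3_def
  define \<pi>1 where "\<pi>1 = transpose (0 :: nat, a) (1, a)"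
  define \<pi>2 where "\<pi>2 = transpose (0 :: nat, a) (2, a)"
  define \<pi>3 where "\<pi>3 = transpose (1 :: nat, a) (2, a)"
  note \<pi> = \<pi>1_def \<pi>2_def \<pi>3_def
  define B where "B = {0 :: nat} \<times> D0 \<union> {1} \<times> D1"
  have finD: "finite D0" "finite D1" using D mN(4) finite_subset by blast+
  show ?thesis
  proof (rule two_valuedI[where ?V1.0 = V1 and ?V2.0 = V2 and ?V3.0 = V3
        and ?\<pi>1.0 = \<pi>1 and ?\<pi>2.0 = \<pi>2 and ?\<pi>3.0 = \<pi>3 and B = B, OF mN])
    fix c :: nat and t assume ct: "c < 4" "t \<in> R"
    have "odd (snd v) \<Longrightarrow> snd v mod 2 = 1" "even (snd v) \<Longrightarrow> snd v mod 2 = 0" for v :: "int \<times> int"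
      by (simp_all add: odd_iff_mod_2_eq_one)
    moreover have "even (snd \<epsilon>)" using par(5) by (simp add: \<epsilon>_def)
    ultimately show "snd (V1 (c, t)) mod 2 = tau3 c" "snd (V2 (c, t)) mod 2 = tau1 c"
      "snd (V3 (c, t)) mod 2 = tau2 c"
      using ct ev[OF ct(2)] par by (auto simp: V less_4_cases tau1_def tau2_def tau3_def)
  next
    fix c :: nat and t t' assume ct: "c < 4" "t \<in> R" "t' \<in> R"
    note i = inj[OF ct(2,3)] inj[OF ct(3,2)]
    show "t = t'" if "V1 (c, t) - V1 (c, t') \<in> lat m N"
      using that i by (auto simp: V split: if_splits)
    show "t = t'" if "V2 (c, t) - V2 (c, t') \<in> lat m N"
      using that i by (auto simp: V split: if_splits)
    show "t = t'" if "V3 (c, t) - V3 (c, t') \<in> lat m N"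
      using that i by (auto simp: V split: if_splits)
  next
    show "bij_betw \<pi>1 ({..<4} \<times> R) ({..<4} \<times> R)" "bij_betw \<pi>2 ({..<4} \<times> R) ({..<4} \<times> R)"
      "bij_betw \<pi>3 ({..<4} \<times> R) ({..<4} \<times> R)"
      using a unfolding \<pi> by (auto intro!: bij_betw_transpose)
  next
    fix i :: "nat \<times> 'r" assume "i \<in> {..<4} \<times> R"
    then show "tau1 (fst (\<pi>1 i)) = tau1 (fst i)" "tau2 (fst (\<pi>2 i)) = tau2 (fst i)"
      "tau3 (fst (\<pi>3 i)) = tau3 (fst i)"
      by (auto simp: \<pi> transpose_def tau1_def tau2_def tau3_def)
  next
    show "B \<subseteq> {..<4} \<times> R" using D by (auto simp: B_def)
    show "card B = card D0 + card D1"
      unfolding B_def using finD by (subst card_Un_disjoint) (auto simp: card_cartesian_product)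
  next
    fix i :: "nat \<times> 'r" assume i: "i \<in> {..<4} \<times> R"
    obtain c t where [simp]: "i = (c, t)" by (cases i)
    have c: "c = 0 \<or> c = 1 \<or> c = 2 \<or> c = 3" and t: "t \<in> R" using i by (auto simp: less_4_cases)
    have eq: "v \<in> lat m N" if "u \<in> lat m N" "v = u" for u v using that by simp
    have 3: "X t - (\<omega> - X t) + (\<omega> - W t) \<in> lat m N"
      by (rule eq[OF sum[OF t]]) (simp add: algebra_simps)
    show "block_sum (fst i) (V1 (\<pi>1 i)) (V2 (\<pi>2 i)) (V3 (\<pi>3 i)) - (if i \<in> B then \<delta> else 0) \<in> lat m N"
    proof (cases "t = a")
      case True
      have 0: "\<omega> + X a + p + (\<omega> - X a + \<sigma>0 - p) + - Z0 a - (if a \<in> D0 then \<delta> else 0) \<in> lat m N"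
        by (rule eq[OF lat_diff[OF \<omega> Z0(2)]]) (simp add: algebra_simps)
      have 1: "X a + X a - (W a - \<epsilon>) - \<epsilon> \<in> lat m N"
        by (rule eq[OF sum[OF a]]) (simp add: algebra_simps)
      have 2: "\<omega> + X a + p + \<sigma>1 - \<epsilon> - X a - (\<omega> + Z1 a + p) \<in> lat m N"
        by (rule eq[OF lat_uminus[OF Z1(2)]]) (simp add: \<epsilon>_def algebra_simps)
      from 0 1 2 3 show ?thesis
        using c True by (auto simp: block_sum_def \<pi> transpose_def V B_def \<epsilon>_def)
    next
      case False
      have 0: "X t + X t + - Z0 t - (if t \<in> D0 then \<delta> else 0) \<in> lat m N"
        by (rule eq[OF lat_add[OF sum[OF t] Z0(1)[OF t False]]]) (simp add: algebra_simps)
      have 1: "\<omega> + X t + p + X t - (\<omega> + Z1 t + p) - (if t \<in> D1 then \<delta> else 0) \<in> lat m N"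
        by (rule eq[OF lat_add[OF sum[OF t] Z1(1)[OF t False]]]) (simp add: algebra_simps)
      have 2: "\<omega> + X t + p + \<sigma>1 - \<epsilon> - (\<omega> - X t + \<sigma>0 - p) - (W t - \<epsilon>) \<in> lat m N"
        by (rule eq[OF lat_add[OF sum[OF t] p]]) (simp add: algebra_simps)
      from 0 1 2 3 show ?thesis
        using c False by (auto simp: block_sum_def \<pi> transpose_def V B_def)
    qed
  qed
qed

section \<open>The triples of permutations of \<open>2G\<close>\<close>

text \<open>The subgroup \<open>2G\<close> of \<open>G = \<int>\<^sub>m \<times> \<int>\<^sub>2\<^sub>Q\<close> is identified with \<open>\<int>\<^sub>m \<times> \<int>\<^sub>Q\<close>.\<close>

definition emb :: "int \<times> int \<Rightarrow> int \<times> int" where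
  "emb h = (fst h, 2 * snd h)"

lemma emb_in_lat_iff: "emb h \<in> lat m (2 * Q) \<longleftrightarrow> h \<in> lat m Q"
  by (simp add: emb_def lat_def)

lemma emb_diff: "emb u - emb v = emb (u - v)" and emb_add: "emb u + emb v = emb (u + v)"
  by (simp_all add: emb_def)

lemma even_snd_emb: "even (snd (emb h))"
  by (simp add: emb_def)

section \<open>Representatives of \<open>\<int>_m x \<int>_Q\<close>\<close>

lemma box_eqI:
  assumes "h \<in> {0..<m} \<times> {0..<Q}" "h' \<in> {0..<m} \<times> {0..<Q}" "h - h' \<in> lat m Q"
  shows "h = h'"
  using assms eq_if_dvd_diff[of m "fst h" "fst h'"] eq_if_dvd_diff[of Q "snd h" "snd h'"]
  by (simp add: lat_def mem_Times_iff prod_eq_iff)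

text \<open>Reduction makes \<open>f\<close> a bijection from \<open>R\<close> onto the box, and
  \<open>P\<close> does not notice the reduction.\<close>

lemma card_Collect_transversal:
  fixes f :: "'r \<Rightarrow> int \<times> int"
  assumes "m > 0" "Q > 0" "finite R" "card R = nat m * nat Q"
    and inj: "\<And>t t'. t \<in> R \<Longrightarrow> t' \<in> R \<Longrightarrow> f t - f t' \<in> lat m Q \<Longrightarrow> t = t'"
    and inv: "\<And>u v. u - v \<in> lat m Q \<Longrightarrow> P u = P v"
  shows "card {t \<in> R. P (f t)} = card {h \<in> {0..<m} \<times> {0..<Q}. P h}"
proof -
  let ?box = "{0..<m} \<times> {0..<Q}"
  define r where "r h = (fst h mod m, snd h mod Q)" for h
  have P_r: "P (r h) = P h" for h
    by (rule inv) (simp add: r_def lat_def iffD1[OF mod_eq_dvd_iff, OF mod_mod_trivial])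
  have i: "inj_on (r \<circ> f) R"
  proof (rule inj_onI)
    fix t t' assume "t \<in> R" "t' \<in> R" "(r \<circ> f) t = (r \<circ> f) t'"
    then show "t = t'"
      using inj[of t t'] iffD1[OF mod_eq_dvd_iff, of "fst (f t)" m "fst (f t')"]
        iffD1[OF mod_eq_dvd_iff, of "snd (f t)" Q "snd (f t')"]
      unfolding r_def lat_def o_apply by fastforce
  qed
  have img: "(r \<circ> f) ` R = ?box"
  proof (rule card_subset_eq)
    show "card ((r \<circ> f) ` R) = card ?box"
      using card_image[OF i] assms(4) by (simp add: card_cartesian_product)
  qed (use assms(1,2) in \<open>auto simp: r_def\<close>)
  have "{h \<in> ?box. P h} = (r \<circ> f) ` {t \<in> R. P ((r \<circ> f) t)}"
    unfolding img[symmetric] by auto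
  then have "{h \<in> ?box. P h} = (r \<circ> f) ` {t \<in> R. P (f t)}"
    by (simp only: P_r o_apply)
  then show ?thesis
    using card_image[OF inj_on_subset[OF i, of "{t \<in> R. P (f t)}"]] by simp
qed

lemma odd_dvd_double: "n dvd c" if "odd n" "n dvd 2 * c" for n c :: int
  using that coprime_dvd_mult_right_iff[of n 2 c] by (simp add: coprime_right_2_iff_odd)

text \<open>Blocks 0 and 1 can each carry up to \<open>m * Q\<close> sums \<open>\<delta>\<close>.
  So \<open>b\<close> is divided between them, and each gets its own shift of the doubling map,
  which permutes because \<open>m\<close> and \<open>Q\<close> are odd.\<close>

lemma two_valued_odd:
  fixes m Q :: int
  assumes m: "m > 0" "odd m" and Q: "Q > 0" "odd Q" and b: "int b \<le> 2 * (m * Q)"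
  shows "two_valued m (2 * Q) (m - 1, -2) b"
proof -
  define b0 where "b0 = min b (nat (m * Q))"
  define b1 where "b1 = b - b0"
  have mQ: "m * Q > 0" using m Q by simp
  have b01: "int b0 \<le> m * Q" "int b1 \<le> m * Q" "b0 + b1 = b"
    using b mQ by (auto simp: b0_def b1_def)
  obtain P0 where P0: "\<forall>u v. u - v \<in> lat m Q \<longrightarrow> P0 u = P0 v"
      "card {h \<in> {0..<m} \<times> {0..<Q}. P0 h} = b0" "int b0 < m * Q \<longrightarrow> \<not> P0 (1, 1)"
      "\<forall>h h'. shift_map m Q b0 P0 h - shift_map m Q b0 P0 h' \<in> lat m Q \<longrightarrow> h - h' \<in> lat m Q"
    using exists_shift_set[OF m(1) Q(1) b01(1)] by (elim exE conjE) (rule that)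
  note P0 = P0[rule_format]
  obtain P1 where P1: "\<forall>u v. u - v \<in> lat m Q \<longrightarrow> P1 u = P1 v"
      "card {h \<in> {0..<m} \<times> {0..<Q}. P1 h} = b1" "int b1 < m * Q \<longrightarrow> \<not> P1 (1, 1)"
      "\<forall>h h'. shift_map m Q b1 P1 h - shift_map m Q b1 P1 h' \<in> lat m Q \<longrightarrow> h - h' \<in> lat m Q"
    using exists_shift_set[OF m(1) Q(1) b01(2)] by (elim exE conjE) (rule that)
  note P1 = P1[rule_format]
  let ?R = "{0..<m} \<times> {0..<Q}"
  define W where "W h = h + h" for h :: "int \<times> int"
  have W_inj: "t = t'" if "t \<in> ?R" "t' \<in> ?R" "W t - W t' \<in> lat m Q" for t t'
  proof (rule box_eqI[OF that(1,2)])
    have "m dvd 2 * (fst t - fst t')" "Q dvd 2 * (snd t - snd t')"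
      using that(3) by (simp_all add: W_def lat_def algebra_simps)
    from odd_dvd_double[OF m(2) this(1)] odd_dvd_double[OF Q(2) this(2)] show "t - t' \<in> lat m Q"
      by (simp add: lat_def)
  qed
  define D0 where "D0 = {t \<in> ?R. P0 (W t)}"
  define D1 where "D1 = {t \<in> ?R. P1 (W t)}"
  have cR: "card ?R = nat m * nat Q" by (simp add: card_cartesian_product)
  have cD: "card D0 = b0" "card D1 = b1"
    unfolding D0_def D1_def P0(2)[symmetric] P1(2)[symmetric]
    by (rule card_Collect_transversal[OF m(1) Q(1) _ cR W_inj P0(1)]; simp)
      (rule card_Collect_transversal[OF m(1) Q(1) _ cR W_inj P1(1)]; simp)
  define S where "S b' P h = emb (shift_map m Q b' P (W h))" for b' P h
  have zero: "(0, 0) \<in> ?R" using m Q by simp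
  have S: "t \<noteq> (0, 0) \<Longrightarrow> emb (W t) - S b' P t - (if t \<in> {t \<in> ?R. P (W t)} then (m - 1, -2) else 0) \<in> lat m (2 * Q)"
    "S b' P (0, 0) - ((- int b', - 2 * int b') - (if (0, 0) \<in> {t \<in> ?R. P (W t)} then (m - 1, -2) else 0)) \<in> lat m (2 * Q)"
    if "t \<in> ?R" for t b' P
  proof -
    assume t0: "t \<noteq> (0, 0)"
    have "W t \<notin> lat m Q"
      using W_inj[OF that zero] t0 unfolding W_def by (metis add_0 diff_zero zero_prod_def)
    then have "S b' P t = emb (if P (W t) then W t + (1, 1) else W t)"
      unfolding S_def shift_map_def by (simp only: if_False)
    then show "emb (W t) - S b' P t - (if t \<in> {t \<in> ?R. P (W t)} then (m - 1, -2) else 0) \<in> lat m (2 * Q)"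
      using that by (simp add: emb_def lat_def)
  next
    show "S b' P (0, 0) - ((- int b', - 2 * int b') - (if (0, 0) \<in> {t \<in> ?R. P (W t)} then (m - 1, -2) else 0)) \<in> lat m (2 * Q)"
      using zero by (simp add: S_def shift_map_def W_def emb_def lat_def zero_prod_def)
  qed
  define c where "c = int b1 - int b0"
  \<comment> \<open>For halving \<open>\<sigma>0 - \<sigma>1 = (c, 2 * c)\<close>: modulo
    \<open>m\<close>, \<open>-h\<close> is the inverse of 2. The second coordinate of
    \<open>p\<close> will be \<open>c * (1 - Q)\<close> instead of \<open>c\<close>, which is even
    for every \<open>c\<close>.\<close>
  obtain h where h: "m = 2 * h + 1" using m(2) by (rule oddE)
  have "two_valued m (2 * Q) (m - 1, -2) (card D0 + card D1)"
  proof (rule two_valued_complete[where R = ?R and a = "(0, 0)" and X = emb and W = "\<lambda>t. emb (W t)"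
        and ?Z0.0 = "S b0 P0" and ?Z1.0 = "S b1 P1" and \<omega> = "(0, Q)"
        and p = "(- c * h, - c * (Q - 1))"
        and ?\<sigma>0.0 = "(- int b0, - 2 * int b0)" and ?\<sigma>1.0 = "(- int b1, - 2 * int b1)"])
    show "4 * card ?R = 2 * nat m * nat (2 * Q)" using Q by (simp add: cR nat_mult_distrib)
    show "t = t'" if "t \<in> ?R" "t' \<in> ?R" "emb t - emb t' \<in> lat m (2 * Q)" for t t'
      by (rule box_eqI[OF that(1,2)]) (use that(3) in \<open>simp only: emb_diff emb_in_lat_iff\<close>)
    show "t = t'" if "t \<in> ?R" "t' \<in> ?R" "emb (W t) - emb (W t') \<in> lat m (2 * Q)" for t t'
      by (rule W_inj[OF that(1,2)]) (use that(3) in \<open>simp only: emb_diff emb_in_lat_iff\<close>)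
    show "t = t'" if "t \<in> ?R" "t' \<in> ?R" "S b0 P0 t - S b0 P0 t' \<in> lat m (2 * Q)" for t t'
      by (rule W_inj[OF that(1,2) P0(4)]) (use that(3) in \<open>simp only: S_def emb_diff emb_in_lat_iff\<close>)
    show "t = t'" if "t \<in> ?R" "t' \<in> ?R" "S b1 P1 t - S b1 P1 t' \<in> lat m (2 * Q)" for t t'
      by (rule W_inj[OF that(1,2) P1(4)]) (use that(3) in \<open>simp only: S_def emb_diff emb_in_lat_iff\<close>)
    have "(- c * h, - c * (Q - 1)) + (- c * h, - c * (Q - 1))
        - ((- int b0, - 2 * int b0) - (- int b1, - 2 * int b1)) = (m * - c, (2 * Q) * - c)"
      by (simp add: c_def h algebra_simps)
    then show "(- c * h, - c * (Q - 1)) + (- c * h, - c * (Q - 1))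
        - ((- int b0, - 2 * int b0) - (- int b1, - 2 * int b1)) \<in> lat m (2 * Q)"
      unfolding lat_def by (simp only: mem_Collect_eq fst_conv snd_conv dvd_triv_left simp_thms)
    show "emb (W t) - S b0 P0 t - (if t \<in> D0 then (m - 1, -2) else 0) \<in> lat m (2 * Q)"
      "emb (W t) - S b1 P1 t - (if t \<in> D1 then (m - 1, -2) else 0) \<in> lat m (2 * Q)"
      if "t \<in> ?R" "t \<noteq> (0, 0)" for t
      unfolding D0_def D1_def by (rule S(1)[OF that])+
    show "S b0 P0 (0, 0) - ((- int b0, - 2 * int b0) - (if (0, 0) \<in> D0 then (m - 1, -2) else 0)) \<in> lat m (2 * Q)"
      "S b1 P1 (0, 0) - ((- int b1, - 2 * int b1) - (if (0, 0) \<in> D1 then (m - 1, -2) else 0)) \<in> lat m (2 * Q)"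
      unfolding D0_def D1_def by (rule S(2)[OF zero])+
  qed (use m Q zero in \<open>auto simp: even_snd_emb S_def D0_def D1_def lat_def W_def emb_def\<close>)
  then show ?thesis using cD b01(3) by simp
qed

text \<open>All elements of \<open>\<int>_m x \<int>_2M\<close> add up to the involution
  \<open>(0, M)\<close>, so permutations with \<open>X + Y = W\<close> throughout cannot exist; a
  single bad row with this defect is the best possible.\<close>

lemma two_valued_even:
  fixes m M :: int
  assumes m: "m > 0" "odd m" and M: "M > 0" and b: "int b \<le> 2 * (m * (2 * M))"
  shows "two_valued m (2 * (2 * M)) (m - 1, -2) b"
proof -
  define Q where "Q = 2 * M"
  define T where "T = m * M"
  have Q: "Q > 0" and T: "T > 0" and mQ: "m * Q = 2 * T"
    using m M by (auto simp: Q_def T_def)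
  define b1 where "b1 = b div 2"
  have bb: "b = 2 * b1 + of_bool (odd b)" by (simp add: b1_def)
  \<comment> \<open>For odd \<open>b\<close> the strict bound keeps \<open>(1, 1)\<close>, which
    will be \<open>W' 0\<close>, out of \<open>P\<close>; row \<open>0\<close> is then free for the
    odd exchange.\<close>
  have b1: "int b1 \<le> m * Q" "odd b \<Longrightarrow> int b1 < m * Q"
    using b bb mQ unfolding Q_def[symmetric] by (auto split: if_splits)
  obtain P where P: "\<forall>u v. u - v \<in> lat m Q \<longrightarrow> P u = P v"
      "card {h \<in> {0..<m} \<times> {0..<Q}. P h} = b1" "int b1 < m * Q \<longrightarrow> \<not> P (1, 1)"
      "\<forall>h h'. shift_map m Q b1 P h - shift_map m Q b1 P h' \<in> lat m Q \<longrightarrow> h - h' \<in> lat m Q"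
    using exists_shift_set[OF m(1) Q b1(1)] by (elim exE conjE) (rule that)
  note P = P[rule_format]
  let ?R = "{0..<2 * T}"
  \<comment> \<open>\<open>x\<close> enumerates \<open>\<int>\<^sub>m \<times> \<int>\<^sub>2\<^sub>M\<close> so that \<open>x (t + T)\<close> is \<open>x t\<close> plus the involution and the sums of
    consecutive terms in one half cover the elements with odd second coordinate; the doubles cover
    the even ones.\<close>
  define x where "x t = (t div M, t)" for t :: int
  define Y where "Y t = (if t < T then x t else if t < 2 * T - 1 then x (t + 1) else x T)" for t
  define W where "W t = (if t < T then x t + x t else x t + x (t + 1))" for t
  have small: "t = t'" if "n dvd t - t'" "\<bar>t - t'\<bar> < n" for n t t' :: int
    using that dvd_imp_le_int[of "t - t'" n] by auto
  \<comment> \<open>Indices congruent modulo \<open>2 * M\<close> have quotients by \<open>M\<close>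
    differing by an even number, so the first coordinate still separates them when \<open>m\<close>
    and \<open>M\<close> share factors.\<close>
  have x_inj: "t = t'" if tR: "t \<in> ?R" "t' \<in> ?R" and l: "x t - x t' \<in> lat m Q" for t t'
  proof -
    obtain c where c: "t - t' = Q * c" using l by (auto simp: x_def lat_def)
    then have "t = t' + 2 * c * M" by (simp add: Q_def algebra_simps)
    then have "t div M - t' div M = 2 * c" using M by simp
    then have "m dvd 2 * c" using l by (simp add: x_def lat_def)
    then have "m dvd c" by (rule odd_dvd_double[OF m(2)])
    then have "2 * T dvd t - t'" unfolding c by (simp add: T_def Q_def mult.commute mult_dvd_mono)
    then show ?thesis by (rule small) (use tR in auto)
  qed
  have W_inj: "t = t'" if tR: "t \<in> ?R" "t' \<in> ?R" and l: "W t - W t' \<in> lat m Q" for t t'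
  proof -
    \<comment> \<open>Doubles have even and consecutive sums odd second coordinate, and this parity
      is visible modulo \<open>Q\<close>.\<close>
    have par: "t < T \<longleftrightarrow> t' < T"
    proof -
      have "Q dvd snd (W t) - snd (W t')" using l by (simp add: lat_def)
      then have "even (snd (W t) - snd (W t'))" unfolding Q_def by (rule dvd_mult_left)
      then show ?thesis by (auto simp: W_def x_def split: if_splits)
    qed
    have "Q dvd 2 * (t - t')"
      using l par by (auto simp: W_def x_def lat_def algebra_simps split: if_splits)
    then have "M dvd t - t'" by (simp only: Q_def dvd_times_left_cancel_iff[of 2] zero_neq_numeral[symmetric] simp_thms)
    then obtain c where c: "t - t' = c * M" by (metis dvdE mult.commute)
    then have t: "t = t' + c * M" by simp
    have "(t + 1) div M - (t' + 1) div M = c" "t div M - t' div M = c"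
      unfolding t using M div_mult_self1[of M "t' + 1" c] by (simp_all add: ac_simps)
    then have "m dvd 2 * c"
      using l par by (auto simp: W_def x_def lat_def algebra_simps split: if_splits)
    then have "m dvd c" by (rule odd_dvd_double[OF m(2)])
    then have "T dvd t - t'" unfolding c T_def by (simp add: mult_dvd_mono)
    then show ?thesis by (rule small) (use tR par in auto)
  qed
  have Y_inj: "t = t'" if tR: "t \<in> ?R" "t' \<in> ?R" and l: "Y t - Y t' \<in> lat m Q" for t t'
  proof -
    define i where "i t = (if t < T then t else if t < 2 * T - 1 then t + 1 else T)" for t
    have "Y t = x (i t)" for t by (simp add: Y_def i_def)
    then have "i t = i t'" using x_inj[of "i t" "i t'"] tR l T by (auto simp: i_def split: if_splits)
    then show ?thesis using tR by (auto simp: i_def split: if_splits)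
  qed
  \<comment> \<open>At the last index \<open>Y\<close> wraps around to \<open>x T\<close>, while
    \<open>W\<close> continues with \<open>x (2 * T)\<close>; the difference is the
    involution.\<close>
  define a where "a = 2 * T - 1"
  have aR: "a \<in> ?R" "0 \<in> ?R" "a \<noteq> 0" using T by (auto simp: a_def)
  have Tdiv: "T div M = m" "(2 * T) div M = 2 * m" "(2 * T - 1) div M = 2 * m - 1"
  proof -
    show "T div M = m" "(2 * T) div M = 2 * m" using M by (simp_all add: T_def)
    have "2 * T - 1 = (M - 1) + (2 * m - 1) * M" by (simp add: T_def algebra_simps)
    then have "(2 * T - 1) div M = (M - 1) div M + (2 * m - 1)"
      using M by (simp only: div_mult_self1 less_irrefl)
    then show "(2 * T - 1) div M = 2 * m - 1" using M by (simp add: div_pos_pos_trivial)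
  qed
  have QT: "Q dvd 2 * T" and QTM: "Q dvd T - M"
  proof -
    show "Q dvd 2 * T" by (simp add: Q_def T_def)
    have "T - M = (m - 1) * M" by (simp add: T_def algebra_simps)
    then show "Q dvd T - M" using m(2) by (simp add: Q_def mult_dvd_mono)
  qed
  have xa: "x a + (1, 1) \<in> lat m Q"
    using QT by (simp add: x_def a_def lat_def Tdiv)
  have Ya: "Y a - (0, M) \<in> lat m Q"
    using QTM T by (simp add: Y_def a_def x_def lat_def Tdiv)
  have Wa: "W a + (1, 1) \<in> lat m Q"
    using dvd_add[OF QT QT] T by (simp add: W_def a_def x_def lat_def Tdiv)
  have x0: "x 0 = 0" "Y 0 = 0" "W 0 = 0" using T by (simp_all add: x_def Y_def W_def zero_prod_def)
  have xY: "x t + Y t = W t" if "t \<in> ?R" "t \<noteq> a" for t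
    using that by (auto simp: Y_def W_def a_def)
  \<comment> \<open>Since \<open>W a\<close> is \<open>(-1, -1)\<close> modulo the lattice, the
    translation puts the freely chosen value of \<open>shift_map\<close> into the bad row
    \<open>a\<close>.\<close>
  define W' where "W' t = W t + (1, 1)" for t
  define Z where "Z t = shift_map m Q b1 P (W' t) - (1, 1)" for t
  define D where "D = {t \<in> ?R. P (W' t)}"
  have W'_inj: "t = t'" if "t \<in> ?R" "t' \<in> ?R" "W' t - W' t' \<in> lat m Q" for t t'
    using W_inj[OF that(1,2)] that(3) by (simp add: W'_def)
  have "nat m * nat Q = nat (m * Q)" using m by (simp add: nat_mult_distrib)
  then have cR: "card ?R = nat m * nat Q" by (simp only: mQ card_atLeastLessThan_int diff_zero)
  have cD: "card D = b1"
    unfolding D_def P(2)[symmetric]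
    by (rule card_Collect_transversal[OF m(1) Q _ cR W'_inj P(1)]) auto
  have Za: "Z a = (of_bool (P 0) - int b1 - 1, of_bool (P 0) - int b1 - 1)"
    using Wa by (simp add: Z_def shift_map_def W'_def)
  have Da: "a \<in> D \<longleftrightarrow> P 0"
    using P(1)[of "W' a" 0] Wa aR by (simp add: D_def W'_def)
  have Zt: "Z t = (if t \<in> D then W t + (1, 1) else W t)" if "t \<in> ?R" "t \<noteq> a" for t
  proof -
    have "W' t \<notin> lat m Q"
      using W'_inj[OF that(1) aR(1)] that(2) lat_diff[of "W' t" m Q "W' a"] Wa by (auto simp: W'_def)
    then show ?thesis using that by (simp add: Z_def shift_map_def D_def W'_def)
  qed
  have emb_diff_\<delta>: "emb u - (m - 1, -2) \<in> lat m (2 * Q)" if "u + (1, 1) \<in> lat m Q" for u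
  proof -
    have "emb u - (m - 1, -2) = emb (u + (1, 1)) - (m, 0)" by (simp add: emb_def)
    moreover have "emb (u + (1, 1)) \<in> lat m (2 * Q)" using that by (simp only: emb_in_lat_iff)
    moreover have "(m, 0) \<in> lat m (2 * Q)" by (simp add: lat_def)
    ultimately show ?thesis using lat_diff by metis
  qed
  \<comment> \<open>The representative \<open>m - 1\<close> of \<open>-1\<close> is even, so
    \<open>\<delta>\<close> is exactly twice a pair with second coordinate \<open>-1\<close>, which
    is odd as \<open>\<theta>\<close> requires.\<close>
  have h: "(m - 1) div 2 + (m - 1) div 2 = m - 1" using m(2) by simp
  have "two_valued m (2 * Q) (m - 1, -2) (2 * card D + of_bool (odd b))"
  proof (rule two_valued_near_complete[where R = ?R and a = a and o' = 0
        and X = "\<lambda>t. emb (x t)" and Y = "\<lambda>t. emb (Y t)" and W = "\<lambda>t. emb (W t)" and Z = "\<lambda>t. emb (Z t)"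
        and \<theta> = "((m - 1) div 2, -1)" and \<iota> = "emb (0, M)" and \<sigma> = "emb (- int b1, - int b1)"])
    show "4 * card ?R = 2 * nat m * nat (2 * Q)" unfolding cR using Q by (simp add: nat_mult_distrib)
    show "t = t'" if "t \<in> ?R" "t' \<in> ?R" "emb (x t) - emb (x t') \<in> lat m (2 * Q)" for t t'
      by (rule x_inj[OF that(1,2)]) (use that(3) in \<open>simp only: emb_diff emb_in_lat_iff\<close>)
    show "t = t'" if "t \<in> ?R" "t' \<in> ?R" "emb (Y t) - emb (Y t') \<in> lat m (2 * Q)" for t t'
      by (rule Y_inj[OF that(1,2)]) (use that(3) in \<open>simp only: emb_diff emb_in_lat_iff\<close>)
    show "t = t'" if "t \<in> ?R" "t' \<in> ?R" "emb (W t) - emb (W t') \<in> lat m (2 * Q)" for t t'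
      by (rule W_inj[OF that(1,2)]) (use that(3) in \<open>simp only: emb_diff emb_in_lat_iff\<close>)
    show "t = t'" if "t \<in> ?R" "t' \<in> ?R" "emb (Z t) - emb (Z t') \<in> lat m (2 * Q)" for t t'
      by (rule W'_inj[OF that(1,2) P(4)])
        (use that(3) in \<open>simp only: emb_diff emb_in_lat_iff Z_def diff_diff_eq2 diff_add_cancel\<close>)
    show "(m - 1, -2) = ((m - 1) div 2, -1) + ((m - 1) div 2, - 1 :: int)" using h by simp
    show "emb (x t) + emb (Y t) - emb (W t) \<in> lat m (2 * Q)" if "t \<in> ?R" "t \<noteq> a" for t
      using xY[OF that] by (simp add: emb_add lat_zero)
    show "emb (x a) - (m - 1, -2) \<in> lat m (2 * Q)" "emb (W a) - (m - 1, -2) \<in> lat m (2 * Q)"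
      by (rule emb_diff_\<delta>, rule xa) (rule emb_diff_\<delta>, rule Wa)
    show "emb (Y a) - emb (0, M) \<in> lat m (2 * Q)"
      using Ya by (simp only: emb_diff emb_in_lat_iff)
    show "emb (W t) - emb (Z t) - (if t \<in> D then (m - 1, -2) else 0) \<in> lat m (2 * Q)"
      if "t \<in> ?R" "t \<noteq> a" for t
      using Zt[OF that] by (auto simp: emb_def lat_def)
    show "emb (Z a) - ((m - 1, -2) + emb (- int b1, - int b1) - (if a \<in> D then (m - 1, -2) else 0))
        \<in> lat m (2 * Q)"
      by (simp add: Za Da emb_def lat_def)
    show "odd b \<Longrightarrow> 0 \<notin> D"
      using P(3) b1(2) by (simp add: D_def W'_def x0)
  qed (use m Q aR in \<open>auto simp: even_snd_emb x0 emb_def D_def lat_zero zero_prod_def[symmetric]\<close>)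
  then show ?thesis using cD bb by (simp add: Q_def)
qed

section \<open>Row-sum matrices\<close>

lemma two_valued_exists:
  fixes m n k b :: nat
  assumes "odd m" "odd n" "b \<le> 2 ^ (k + 1) * m * n"
  shows "two_valued (int m) (int (2 ^ (k + 1) * n)) (int m - 1, -2) b"
proof -
  have pos: "m > 0" "n > 0" using assms by (auto elim: oddE)
  show ?thesis
  proof (cases k)
    case 0
    have "int b \<le> int (2 ^ (k + 1) * m * n)" using assms(3) by (simp only: of_nat_le_iff)
    then have "int b \<le> 2 * (int m * int n)" by (simp add: 0 ac_simps)
    then show ?thesis using two_valued_odd[of "int m" "int n" b] pos assms 0 by simp
  next
    case (Suc k')
    have "int b \<le> int (2 ^ (k + 1) * m * n)" using assms(3) by (simp only: of_nat_le_iff)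
    then have "int b \<le> 2 * (int m * (2 * (2 ^ k' * int n)))" by (simp add: Suc ac_simps)
    then show ?thesis
      using two_valued_even[of "int m" "2 ^ k' * int n" b] pos assms Suc by (simp add: ac_simps)
  qed
qed

section \<open>Row sums, three columns, and the addition of columns\<close>

lemma row_sum_Suc: "row_sum G M (Suc g) i = row_sum G M g i \<otimes>\<^bsub>G\<^esub> M i g"
  by (simp add: row_sum_def)

lemma row_sum_cong:
  assumes "\<And>j. j < g \<Longrightarrow> M i j = M' i j"
  shows "row_sum G M g i = row_sum G M' g i"
  using assms by (induction g) (simp_all add: row_sum_Suc, simp add: row_sum_def)

lemma (in group) row_sum_closed:
  assumes "\<And>j. j < g \<Longrightarrow> M i j \<in> carrier G"
  shows "row_sum G M g i \<in> carrier G"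
  using assms by (induction g) (simp_all add: row_sum_Suc, simp add: row_sum_def)

text \<open>Each entry \<open>z\<close> of the last column is replaced by the adjacent entries
  \<open>f z\<close> and \<open>h z\<close>; associativity preserves the row sums.\<close>

lemma (in group) RSM_exists_Suc:
  assumes f: "bij_betw f (carrier G) (carrier G)" and h: "bij_betw h (carrier G) (carrier G)"
    and fh: "\<And>z. z \<in> carrier G \<Longrightarrow> f z \<otimes> h z = z"
    and ex: "RSM_exists G (carrier G) g L" and "g > 0"
  shows "RSM_exists G (carrier G) (Suc g) L"
proof -
  obtain M where M: "\<And>j. j < g \<Longrightarrow> bij_betw (\<lambda>i. M i j) {..<card (carrier G)} (carrier G)"
    "image_mset (\<lambda>i. ord (row_sum G M g i)) (mset [0..<card (carrier G)]) = L"
    using ex by (auto simp: RSM_exists_def is_RSM_def)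
  obtain g' where g': "g = Suc g'" using \<open>g > 0\<close> by (cases g) auto
  define M' where "M' i j = (if j < g' then M i j else if j = g' then f (M i g') else h (M i g'))" for i j
  have "bij_betw (\<lambda>i. M' i j) {..<card (carrier G)} (carrier G)" if j: "j < Suc g" for j
  proof -
    consider "j < g'" | "j = g'" | "j = g" using j g' by linarith
    then show ?thesis
    proof cases
      case 1
      then show ?thesis using M(1)[of j] g' by (simp add: M'_def)
    next
      case 2
      then show ?thesis using bij_betw_trans[OF M(1)[of g'] f] g' by (simp add: M'_def o_def)
    next
      case 3
      then show ?thesis using bij_betw_trans[OF M(1)[of g'] h] g' by (simp add: M'_def o_def)
    qed
  qed
  moreover have "row_sum G M' (Suc g) i = row_sum G M g i" if "i < card (carrier G)" for i
  proof -
    have in_carrier: "M i j \<in> carrier G" if "j < g" for j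
      using M(1)[OF that] \<open>i < card (carrier G)\<close> by (auto dest: bij_betwE)
    let ?z = "M i g'"
    have z: "?z \<in> carrier G" "f ?z \<in> carrier G" "h ?z \<in> carrier G"
      using in_carrier[of g'] g' f h by (auto dest: bij_betwE)
    have r: "row_sum G M g' i \<in> carrier G" using in_carrier g' by (intro row_sum_closed) simp
    have "row_sum G M' g' i = row_sum G M g' i" by (rule row_sum_cong) (simp add: M'_def)
    then have "row_sum G M' (Suc g) i = row_sum G M g' i \<otimes> f ?z \<otimes> h ?z"
      by (simp add: g' row_sum_Suc M'_def)
    also have "\<dots> = row_sum G M g' i \<otimes> ?z" using z r fh by (simp add: m_assoc)
    finally show ?thesis by (simp add: g' row_sum_Suc)
  qed
  then have "image_mset (\<lambda>i. ord (row_sum G M' (Suc g) i)) (mset [0..<card (carrier G)]) = L"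
    unfolding M(2)[symmetric] by (intro image_mset_cong) simp
  ultimately show ?thesis unfolding RSM_exists_def is_RSM_def by blast
qed

text \<open>If \<open>f1 f2 f3 = 1\<close> in every row, then \<open>f1 f2\<close> is the inverse of
  \<open>f3\<close>, which runs once through the group and can serve as the row index.\<close>

lemma two_valued_0_factorization:
  assumes mN: "m > 0" "N > 0" and tv: "two_valued m N \<delta> 0"
  obtains f h where "bij_betw f (carrier (gen_dihedral m N)) (carrier (gen_dihedral m N))"
    "bij_betw h (carrier (gen_dihedral m N)) (carrier (gen_dihedral m N))"
    "\<And>z. z \<in> carrier (gen_dihedral m N) \<Longrightarrow> f z \<otimes>\<^bsub>gen_dihedral m N\<^esub> h z = z"
proof -
  interpret group "gen_dihedral m N" using mN by (rule group_gen_dihedral)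
  let ?G = "gen_dihedral m N"
  let ?C = "carrier ?G"
  obtain f1 f2 f3 B where f: "bij_betw f1 {..<card ?C} ?C" "bij_betw f2 {..<card ?C} ?C"
      "bij_betw f3 {..<card ?C} ?C" and B: "B \<subseteq> {..<card ?C}" "card B = 0"
    and row: "\<And>i. i < card ?C \<Longrightarrow> gd_mult m N (gd_mult m N (f1 i) (f2 i)) (f3 i) =
      gd_red m N (if i \<in> B then \<delta> else 0) 0"
    using tv unfolding two_valued_def Let_def by blast
  have "B = {}" using B finite_subset[OF B(1)] by simp
  then have row1: "f1 i \<otimes>\<^bsub>?G\<^esub> f2 i \<otimes>\<^bsub>?G\<^esub> f3 i = \<one>\<^bsub>?G\<^esub>" if "i < card ?C" for i
    using row[OF that] by (simp add: one_gen_dihedral)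
  define e where "e z = inv_into {..<card ?C} f3 (inv\<^bsub>?G\<^esub> z)" for z
  have inv: "bij_betw (\<lambda>z. inv\<^bsub>?G\<^esub> z) ?C ?C"
    by (rule bij_betw_byWitness[where f' = "\<lambda>z. inv\<^bsub>?G\<^esub> z"]) auto
  have e: "bij_betw e ?C {..<card ?C}"
    using bij_betw_trans[OF inv bij_betw_inv_into[OF f(3)]] by (simp add: e_def[abs_def] o_def)
  show ?thesis
  proof (rule that[OF bij_betw_trans[OF e f(1)] bij_betw_trans[OF e f(2)]])
    fix z assume z: "z \<in> ?C"
    then have ez: "e z < card ?C" using e by (auto dest: bij_betwE)
    then have c: "f1 (e z) \<in> ?C" "f2 (e z) \<in> ?C" "f3 (e z) \<in> ?C" using f by (auto dest: bij_betwE)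
    have f3: "f3 (e z) = inv\<^bsub>?G\<^esub> z"
      using z f(3) unfolding e_def by (intro bij_betw_inv_into_right) auto
    have "f1 (e z) \<otimes>\<^bsub>?G\<^esub> f2 (e z) = inv\<^bsub>?G\<^esub> (f3 (e z))"
      using inv_equality[OF row1[OF ez]] c by (simp del: mult_gen_dihedral)
    then show "(f1 \<circ> e) z \<otimes>\<^bsub>?G\<^esub> (f2 \<circ> e) z = z" using f3 z by simp
  qed
qed

lemma image_mset_if_upt:
  assumes "B \<subseteq> {..<c}"
  shows "image_mset (\<lambda>i. if i \<in> B then u else v) (mset [0..<c]) =
    replicate_mset (card B) u + replicate_mset (c - card B) v"
proof -
  have fin: "finite B" using assms finite_subset by blast
  have "mset [0..<c] = mset_set {..<c}" by (simp add: mset_upt atLeast0LessThan)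
  also have "{..<c} = B \<union> ({..<c} - B)" using assms by blast
  also have "mset_set \<dots> = mset_set B + mset_set ({..<c} - B)"
    by (rule mset_set_Union) (use fin in auto)
  finally have *: "mset [0..<c] = mset_set B + mset_set ({..<c} - B)" .
  have "image_mset (\<lambda>i. if i \<in> B then u else v) (mset_set B) = image_mset (\<lambda>_. u) (mset_set B)"
    by (rule image_mset_cong) (use fin in simp)
  moreover have "image_mset (\<lambda>i. if i \<in> B then u else v) (mset_set ({..<c} - B)) =
      image_mset (\<lambda>_. v) (mset_set ({..<c} - B))"
    by (rule image_mset_cong) simp
  ultimately show ?thesis
    using assms fin unfolding * by (simp add: image_mset_const_eq card_Diff_subset)
qed

text \<open>Right multiplication by the rotation \<open>\<epsilon>\<close> permutes the last column
  and moves the row sums \<open>\<delta>\<close> and \<open>0\<close> to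
  \<open>\<delta> + \<epsilon>\<close> and \<open>\<epsilon>\<close>.\<close>

lemma two_valued_RSM_3:
  assumes mN: "m > 0" "N > 0" and tv: "two_valued m N \<delta> b"
    and u: "group.ord (gen_dihedral m N) (gd_red m N (\<delta> + \<epsilon>) 0) = u"
    and v: "group.ord (gen_dihedral m N) (gd_red m N \<epsilon> 0) = v"
  shows "RSM_exists (gen_dihedral m N) (carrier (gen_dihedral m N)) 3
    (replicate_mset b u + replicate_mset (card (carrier (gen_dihedral m N)) - b) v)"
proof -
  let ?G = "gen_dihedral m N"
  let ?C = "carrier ?G"
  interpret group ?G using mN by (rule group_gen_dihedral)
  obtain f1 f2 f3 B where f: "bij_betw f1 {..<card ?C} ?C" "bij_betw f2 {..<card ?C} ?C"
      "bij_betw f3 {..<card ?C} ?C" and B: "B \<subseteq> {..<card ?C}" "card B = b"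
    and row: "\<And>i. i < card ?C \<Longrightarrow> gd_mult m N (gd_mult m N (f1 i) (f2 i)) (f3 i) =
      gd_red m N (if i \<in> B then \<delta> else 0) 0"
    using tv unfolding two_valued_def Let_def by blast
  let ?x = "gd_red m N \<epsilon> 0"
  have x: "?x \<in> ?C" using mN by (intro gd_red_in_carrier) auto
  define M where "M i j = (if j = 0 then f1 i else if j = 1 then f2 i else f3 i \<otimes>\<^bsub>?G\<^esub> ?x)"
    for i and j :: nat
  have "bij_betw (\<lambda>z. z \<otimes>\<^bsub>?G\<^esub> ?x) ?C ?C"
    using x by (intro bij_betw_byWitness[where f' = "\<lambda>z. z \<otimes>\<^bsub>?G\<^esub> inv\<^bsub>?G\<^esub> ?x"])
      (auto simp: m_assoc simp del: mult_gen_dihedral)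
  from bij_betw_trans[OF f(3) this]
  have f3: "bij_betw (\<lambda>i. f3 i \<otimes>\<^bsub>?G\<^esub> ?x) {..<card ?C} ?C" by (simp only: o_def)
  have cols: "bij_betw (\<lambda>i. M i j) {..<card ?C} ?C" if "j < 3" for j
    using f f3 by (cases "j = 0"; cases "j = 1") (simp_all add: M_def)
  have sums: "row_sum ?G M 3 i = gd_red m N ((if i \<in> B then \<delta> else 0) + \<epsilon>) 0" if "i < card ?C" for i
  proof -
    have c: "f1 i \<in> ?C" "f2 i \<in> ?C" "f3 i \<in> ?C" using f that by (auto dest: bij_betwE)
    have "row_sum ?G M 3 i = \<one>\<^bsub>?G\<^esub> \<otimes>\<^bsub>?G\<^esub> f1 i \<otimes>\<^bsub>?G\<^esub> f2 i \<otimes>\<^bsub>?G\<^esub> (f3 i \<otimes>\<^bsub>?G\<^esub> ?x)"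
      by (simp add: row_sum_def M_def numeral_3_eq_3)
    also have "\<dots> = f1 i \<otimes>\<^bsub>?G\<^esub> f2 i \<otimes>\<^bsub>?G\<^esub> f3 i \<otimes>\<^bsub>?G\<^esub> ?x"
      using c x by (simp add: m_assoc del: mult_gen_dihedral)
    also have "\<dots> = gd_red m N ((if i \<in> B then \<delta> else 0) + \<epsilon>) 0"
      using row[OF that] by (simp add: gd_red_mult)
    finally show ?thesis .
  qed
  have "image_mset (\<lambda>i. ord (row_sum ?G M 3 i)) (mset [0..<card ?C]) =
      image_mset (\<lambda>i. if i \<in> B then u else v) (mset [0..<card ?C])"
    by (rule image_mset_cong) (use u v in \<open>simp add: sums\<close>)
  also have "\<dots> = replicate_mset b u + replicate_mset (card ?C - b) v"
    using image_mset_if_upt[OF B(1)] B(2) by simp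
  finally show ?thesis using cols unfolding RSM_exists_def is_RSM_def by blast
qed

lemma RSM_exists_size:
  assumes "RSM_exists G S g L"
  shows "size L = card S"
  using assms by (auto simp: RSM_exists_def is_RSM_def)

theorem mainTheorem9:
  fixes g k m n \<alpha> \<beta> :: nat
  assumes "g \<ge> 3" and "m \<ge> 1" and "n \<ge> 1" and "odd m" and "odd n"
    and "\<not> (k \<ge> 2 \<and> \<beta> = 0)"
    and "\<not> (k = 1 \<and> (\<alpha> \<in> {0, 2, 4} \<or> \<beta> \<in> {0, 2, 4}))"
  shows "RSM_exists (gen_dihedral (int m) (int (2 ^ (k + 1) * n)))
           (carrier (gen_dihedral (int m) (int (2 ^ (k + 1) * n)))) g
           (replicate_mset \<alpha> m + replicate_mset \<beta> (2 ^ k * n))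
         \<longleftrightarrow> \<alpha> + \<beta> = 2 ^ (k + 2) * m * n"
proof -
  define Q where "Q = 2 ^ k * n"
  define N where "N = 2 ^ (k + 1) * n"
  let ?G = "gen_dihedral (int m) (int N)"
  have N: "N = 2 * Q" by (simp add: N_def Q_def)
  have pos: "int m > 0" "int N > 0" using assms by (auto simp: N_def)
  have card: "card (carrier ?G) = 2 ^ (k + 2) * m * n"
    unfolding card_gen_dihedral nat_int N_def by simp
  have "RSM_exists ?G (carrier ?G) g (replicate_mset \<alpha> m + replicate_mset \<beta> Q)"
    if sum: "\<alpha> + \<beta> = 2 ^ (k + 2) * m * n"
    using \<open>g \<ge> 3\<close>
  proof (induction g rule: dec_induct)
    case base
    have tv: "two_valued (int m) (int N) (int m - 1, -2) b" if "b \<le> 2 ^ (k + 1) * m * n" for b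
      unfolding N_def by (rule two_valued_exists) (use assms that in auto)
    have ord: "group.ord ?G (gd_red (int m) (int N) (1, 0) 0) = m"
      "group.ord ?G (gd_red (int m) (int N) (int m, -2) 0) = Q"
      "group.ord ?G (gd_red (int m) (int N) (0, 2) 0) = Q"
      "group.ord ?G (gd_red (int m) (int N) (int m - 1, 0) 0) = m"
    proof -
      have dvd2: "2 * int Q dvd int j * 2 \<longleftrightarrow> Q dvd j" for j
        by (metis dvd_times_right_cancel_iff int_dvd_int_iff mult.commute zero_neq_numeral)
      have "int m dvd int j * (int m - 1) \<longleftrightarrow> m dvd j" for j
        by (simp add: right_diff_distrib dvd_diff_right_iff)
      then show "group.ord ?G (gd_red (int m) (int N) (int m - 1, 0) 0) = m"
        by (intro ord_gd_red[OF pos]) (simp add: lat_def)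
      show "group.ord ?G (gd_red (int m) (int N) (1, 0) 0) = m"
        "group.ord ?G (gd_red (int m) (int N) (int m, -2) 0) = Q"
        "group.ord ?G (gd_red (int m) (int N) (0, 2) 0) = Q"
        by (rule ord_gd_red[OF pos]; simp add: lat_def N dvd2)+
    qed
    have rest: "card (carrier ?G) - \<beta> = \<alpha>" "card (carrier ?G) - \<alpha> = \<beta>"
      unfolding card sum[symmetric] by simp_all
    show ?case
    \<comment> \<open>Only up to half of the rows can have sum \<open>\<delta>\<close>, so these
      rows get the rarer order. Adding \<open>(1, 0)\<close> gives them order \<open>Q\<close> and
      the others \<open>m\<close>; adding \<open>(0, 2)\<close> does the reverse.\<close>
    proof (cases "\<beta> \<le> \<alpha>")
      case True
      have "RSM_exists ?G (carrier ?G) 3 (replicate_mset \<beta> Q + replicate_mset (card (carrier ?G) - \<beta>) m)"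
        by (rule two_valued_RSM_3[OF pos tv, where \<epsilon> = "(1, 0)"])
          (use True sum ord in \<open>simp_all add: algebra_simps\<close>)
      then show ?thesis unfolding rest by (simp only: add.commute)
    next
      case False
      have "RSM_exists ?G (carrier ?G) 3 (replicate_mset \<alpha> m + replicate_mset (card (carrier ?G) - \<alpha>) Q)"
        by (rule two_valued_RSM_3[OF pos tv, where \<epsilon> = "(0, 2)"])
          (use False sum ord in \<open>simp_all add: algebra_simps\<close>)
      then show ?thesis unfolding rest .
    qed
  next
    case (step g)
    interpret group ?G using pos by (rule group_gen_dihedral)
    have "two_valued (int m) (int N) (int m - 1, -2) 0"
      unfolding N_def by (rule two_valued_exists) (use assms in auto)
    then obtain f h where "bij_betw f (carrier ?G) (carrier ?G)" "bij_betw h (carrier ?G) (carrier ?G)"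
      "\<And>z. z \<in> carrier ?G \<Longrightarrow> f z \<otimes>\<^bsub>?G\<^esub> h z = z"
      using two_valued_0_factorization[OF pos] by blast
    then show ?case by (rule RSM_exists_Suc) (use step in auto)
  qed
  moreover have "\<alpha> + \<beta> = 2 ^ (k + 2) * m * n"
    if "RSM_exists ?G (carrier ?G) g (replicate_mset \<alpha> m + replicate_mset \<beta> Q)"
    using RSM_exists_size[OF that] card by simp
  ultimately show ?thesis unfolding N_def Q_def by blast
qed

end
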